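(* Let $A,B\in \mathrm{GL}(2,\mathbb{Z})$ be hyperbolic matrices, and let $\tau_A,\tau_B,\tau_{A^{-1}}$ denote the unique tracial states on $C^*(G_A^a)$, $C^*(G_B^a)$, $C^*(G_{A^{-1}}^a)$, respectively. If the hyperbolic toral automorphisms $(\mathbb{T}^2,A)$ and $(\mathbb{T}^2,B)$ are topologically conjugate, then the $C^*$-algebras $C^*(G_A^a)$ and $C^*(G_B^a)$ are isomorphic and $$\tau_{A*}(K_0(C^*(G_A^a)))=\tau_{B*}(K_0(C^*(G_B^a))).$$ Also, $$\tau_{A*}(K_0(C^*(G_A^a)))=\tau_{A^{-1}*}(K_0(C^*(G_{A^{-1}}^a))).$$
   Context: A matrix $A\in \mathrm{GL}(2,\mathbb{Z})$ (so $\det A=\pm1$) is hyperbolic if it has no eigenvalue of modulus $1$. Its eigenvalues $\lambda_u,\lambda_s$ are then real, labelled so that $|\lambda_u|>1>|\lambda_s|$; let $v_u,v_s\in\mathbb{R}^2$ be corresponding eigenvectors of Euclidean norm $1$. Let $\mathbb{T}^2=\mathbb{R}^2/\mathbb{Z}^2$ with quotient map $q$ and metric $d(x,y)=\inf\{\|z-w\|: q(z)=x,\ q(w)=y\}$; $A$ acts on $\mathbb{T}^2$ as a homeomorphism. $(\mathbb{T}^2,A)$ and $(\mathbb{T}^2,B)$ are topologically conjugate if there is a homeomorphism $h:\mathbb{T}^2\to\mathbb{T}^2$ with $h\circ A=B\circ h$. The asymptotic groupoid is the equivalence relation $$G_A^a=\{(x,z)\in\mathbb{T}^2\times\mathbb{T}^2:\lim_{n\to\infty}d(A^nx,A^nz)=\lim_{n\to\infty}d(A^{-n}x,A^{-n}z)=0\}$$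 with unit space $\mathbb{T}^2$ (the diagonal), product $(x,z)(z,w)=(x,w)$ and inverse $(x,z)^{-1}=(z,x)$. It carries the standard inductive limit topology for Smale spaces: fix a small $\epsilon>0$ and let $G_n$ be the set of pairs $(x,z)$ such that $z\equiv x+sv_s\equiv x+tv_u \pmod{\mathbb{Z}^2}$ for some real $s,t$ with $|\lambda_s|^n|s|<\epsilon$ and $|\lambda_u|^{-n}|t|<\epsilon$; each $G_n$ has the relative topology from $\mathbb{T}^2\times\mathbb{T}^2$, and $G_A^a=\bigcup_n G_n$ has the inductive limit topology. This makes $G_A^a$ étale, and $C^*(G_A^a)$ is its groupoid $C^*$-algebra. It is known that $C^*(G_A^a)$ has a unique tracial state; $\tau_*$ denotes the homomorphism $K_0\to\mathbb{R}$ induced by a tracial state $\tau$. *)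

theory Defs
  imports "HOL-Analysis.Analysis" "HOL-Algebra.QuotRing" "HOL-Algebra.Module"
begin

section \<open>Hyperbolic matrices in GL(2,Z)\<close>

definition eigenvalue_of :: "'a::field^'n^'n \<Rightarrow> 'a \<Rightarrow> bool" where
  "eigenvalue_of M l \<longleftrightarrow> (\<exists>v. v \<noteq> 0 \<and> M *v v = l *s v)"

text \<open>Over the integers, \<^const>\<open>invertible\<close> says that the inverse has integer entries.\<close>

definition hyperbolic :: "int^2^2 \<Rightarrow> bool" where
  "hyperbolic A \<longleftrightarrow> invertible A \<and>
     \<not> (\<exists>l::complex. eigenvalue_of (map_matrix of_int A) l \<and> cmod l = 1)"

abbreviation real_matrix :: "int^2^2 \<Rightarrow> real^2^2" where
  "real_matrix A \<equiv> map_matrix of_int A"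

definition unstable_eigenvalue :: "int^2^2 \<Rightarrow> real" where
  "unstable_eigenvalue A = (THE l. eigenvalue_of (real_matrix A) l \<and> \<bar>l\<bar> > 1)"

definition stable_eigenvalue :: "int^2^2 \<Rightarrow> real" where
  "stable_eigenvalue A = (THE l. eigenvalue_of (real_matrix A) l \<and> \<bar>l\<bar> < 1)"

definition unstable_vector :: "int^2^2 \<Rightarrow> real^2" where
  "unstable_vector A = (SOME v. norm v = 1 \<and> real_matrix A *v v = unstable_eigenvalue A *s v)"

definition stable_vector :: "int^2^2 \<Rightarrow> real^2" where
  "stable_vector A = (SOME v. norm v = 1 \<and> real_matrix A *v v = stable_eigenvalue A *s v)"


section \<open>The torus\<close>

text \<open>The quotient map is \<open>abs_torus\<close>. The metric induces the quotient topology.\<close>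

quotient_type torus = "real^2" / "\<lambda>x y. \<forall>i. x $ i - y $ i \<in> \<int>"
proof (rule equivpI)
  show "reflp (\<lambda>x y::real^2. \<forall>i. x $ i - y $ i \<in> \<int>)"
    by (rule reflpI) simp
  show "symp (\<lambda>x y::real^2. \<forall>i. x $ i - y $ i \<in> \<int>)"
    by (rule sympI) (metis Ints_minus minus_diff_eq)
  show "transp (\<lambda>x y::real^2. \<forall>i. x $ i - y $ i \<in> \<int>)"
  proof (rule transpI, rule allI)
    fix x y z :: "real^2" and i
    assume "\<forall>i. x $ i - y $ i \<in> \<int>" "\<forall>i. y $ i - z $ i \<in> \<int>"
    then have "(x $ i - y $ i) + (y $ i - z $ i) \<in> \<int>" by (blast intro: Ints_add)
    then show "x $ i - z $ i \<in> \<int>" by simp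
  qed
qed

lemma abs_torus_eq_iff: "abs_torus x = abs_torus y \<longleftrightarrow> (\<forall>i. x $ i - y $ i \<in> \<int>)"
  by (rule torus.abs_eq_iff)

lemma abs_torus_cases: obtains u where "x = abs_torus u"
  by (rule that) (rule Quotient_abs_rep[OF Quotient_torus, symmetric])

instantiation torus :: metric_space
begin

definition dist_torus :: "torus \<Rightarrow> torus \<Rightarrow> real" where
  "dist_torus x y = Inf {norm (z - w) | z w. abs_torus z = x \<and> abs_torus w = y}"

definition uniformity_torus :: "(torus \<times> torus) filter" where
  "uniformity_torus = (INF e\<in>{0<..}. principal {(x, y). dist x y < e})"

definition open_torus :: "torus set \<Rightarrow> bool" where
  "open_torus U \<longleftrightarrow> (\<forall>x\<in>U. eventually (\<lambda>(x', y). x' = x \<longrightarrow> y \<in> U) uniformity)"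

lemma dist_torus_le: "dist (abs_torus z) (abs_torus w) \<le> norm (z - w)"
  unfolding dist_torus_def by (rule cInf_lower) (auto intro!: bdd_belowI[of _ 0])

lemma dist_torus_lessE:
  assumes "dist x y < e"
  obtains z w where "abs_torus z = x" "abs_torus w = y" "norm (z - w) < e"
proof -
  let ?S = "{norm (z - w) | z w. abs_torus z = x \<and> abs_torus w = y}"
  obtain u where "x = abs_torus u" by (rule abs_torus_cases)
  moreover obtain v where "y = abs_torus v" by (rule abs_torus_cases)
  ultimately have "norm (u - v) \<in> ?S" by blast
  then have "?S \<noteq> {}" by blast
  moreover have "Inf ?S < e" using assms by (simp only: dist_torus_def)
  ultimately obtain r where "r \<in> ?S" "r < e" by (rule cInf_lessD[THEN bexE])
  then show ?thesis using that by (elim CollectE exE conjE) metis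
qed

instance
proof
  show "uniformity = (INF e\<in>{0 <..}. principal {(x, y::torus). dist x y < e})"
    by (rule uniformity_torus_def)
  show "open U \<longleftrightarrow> (\<forall>x\<in>U. eventually (\<lambda>(x', y). x' = x \<longrightarrow> y \<in> U) uniformity)" for U :: "torus set"
    by (rule open_torus_def)
  have nonneg: "0 \<le> dist x y" for x y :: torus
  proof (rule ccontr)
    assume "\<not> 0 \<le> dist x y"
    then have "dist x y < 0" by simp
    then obtain z w :: "real^2" where "norm (z - w) < 0" by (rule dist_torus_lessE)
    then show False by simp
  qed
  show "dist x y = 0 \<longleftrightarrow> x = y" for x y :: torus
  proof
    assume "x = y"
    obtain u where "x = abs_torus u" by (rule abs_torus_cases)
    then show "dist x y = 0" using \<open>x = y\<close> dist_torus_le[of u u] nonneg[of x y] by simp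
  next
    assume d: "dist x y = 0"
    obtain z w where zw: "abs_torus z = x" "abs_torus w = y" "norm (z - w) < 1/2"
      by (rule dist_torus_lessE[of x y "1/2"]) (auto simp: d)
    show "x = y"
    proof (rule ccontr)
      assume "x \<noteq> y"
      then have "0 < min (1/2) (norm (z - w))" using zw by auto
      with d have "dist x y < min (1/2) (norm (z - w))" by simp
      then obtain z' w' where zw': "abs_torus z' = x" "abs_torus w' = y"
        "norm (z' - w') < min (1/2) (norm (z - w))"
        by (rule dist_torus_lessE)
      have "(z - w) $ i = (z' - w') $ i" for i
      proof -
        have "(z - z') $ i \<in> \<int>" "(w - w') $ i \<in> \<int>"
          using abs_torus_eq_iff[of z z'] abs_torus_eq_iff[of w w'] zw(1,2) zw'(1,2) by auto
        then have "(z - z') $ i - (w - w') $ i \<in> \<int>" by (rule Ints_diff)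
        then obtain k where k: "(z - w) $ i - (z' - w') $ i = of_int k"
          by (auto elim!: Ints_cases simp: algebra_simps)
        have "\<bar>(z - w) $ i\<bar> < 1/2" "\<bar>(z' - w') $ i\<bar> < 1/2"
          using component_le_norm_cart[of "z - w" i] component_le_norm_cart[of "z' - w'" i]
            zw(3) zw'(3) by linarith+
        then have "\<bar>of_int k :: real\<bar> < 1" using k by linarith
        then have "k = 0" by linarith
        then show ?thesis using k by simp
      qed
      then have "z - w = z' - w'" by (simp add: vec_eq_iff)
      then show False using zw'(3) by simp
    qed
  qed
  show "dist x y \<le> dist x z + dist y z" for x y z :: torus
  proof (rule field_le_epsilon)
    fix e :: real assume "0 < e"
    obtain a c where ac: "abs_torus a = x" "abs_torus c = z" "norm (a - c) < dist x z + e/2"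
      by (rule dist_torus_lessE[of x z "dist x z + e/2"]) (use \<open>0 < e\<close> in auto)
    obtain b c' where bc: "abs_torus b = y" "abs_torus c' = z" "norm (b - c') < dist y z + e/2"
      by (rule dist_torus_lessE[of y z "dist y z + e/2"]) (use \<open>0 < e\<close> in auto)
    have "abs_torus (b + (c - c')) = y"
    proof -
      have "\<forall>i. c $ i - c' $ i \<in> \<int>" using ac(2) bc(2) abs_torus_eq_iff[of c c'] by simp
      then have "abs_torus (b + (c - c')) = abs_torus b" by (simp add: abs_torus_eq_iff)
      then show ?thesis using bc(1) by simp
    qed
    then have "dist x y \<le> norm (a - (b + (c - c')))"
      using dist_torus_le ac(1) by blast
    also have "\<dots> = norm ((a - c) - (b - c'))" by (simp add: algebra_simps)
    also have "\<dots> \<le> norm (a - c) + norm (b - c')" by (rule norm_triangle_ineq4)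
    finally show "dist x y \<le> dist x z + dist y z + e" using ac(3) bc(3) by linarith
  qed
qed

end

lift_definition torus_map :: "int^2^2 \<Rightarrow> torus \<Rightarrow> torus" is "\<lambda>A v. real_matrix A *v v"
proof -
  fix A :: "int^2^2" and x y :: "real^2" and i
  assume "\<And>i. x $ i - y $ i \<in> \<int>"
  then have "(\<Sum>j\<in>UNIV. of_int (A $ i $ j) * (x $ j - y $ j)) \<in> \<int>"
    by (intro Ints_sum Ints_mult) auto
  then show "(real_matrix A *v x) $ i - (real_matrix A *v y) $ i \<in> \<int>"
    by (simp add: matrix_vector_mult_def sum_subtractf right_diff_distrib)
qed

definition topologically_conjugate :: "int^2^2 \<Rightarrow> int^2^2 \<Rightarrow> bool" where
  "topologically_conjugate A B \<longleftrightarrow>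
     (\<exists>h k. homeomorphism UNIV UNIV h k \<and> h \<circ> torus_map A = torus_map B \<circ> h)"


section \<open>The asymptotic groupoid and its topology\<close>

definition asymptotic_groupoid :: "int^2^2 \<Rightarrow> (torus \<times> torus) set" where
  "asymptotic_groupoid A = {(x, z).
     (\<lambda>n. dist ((torus_map A ^^ n) x) ((torus_map A ^^ n) z)) \<longlonglongrightarrow> 0 \<and>
     (\<lambda>n. dist ((torus_map (matrix_inv A) ^^ n) x) ((torus_map (matrix_inv A) ^^ n) z)) \<longlonglongrightarrow> 0}"

text \<open>The inductive limit topology of the pieces below does not depend on \<open>\<epsilon> > 0\<close>: the two
  sequences of pieces for \<open>\<epsilon>\<close> and \<open>\<epsilon>'\<close> are cofinal in each other. The eigenvectors are determined
  up to sign, and the pieces are invariant under a change of sign.\<close>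

definition asymptotic_piece :: "real \<Rightarrow> int^2^2 \<Rightarrow> nat \<Rightarrow> (torus \<times> torus) set" where
  "asymptotic_piece \<epsilon> A n = {(abs_torus x, abs_torus z) | x z. \<exists>s t.
     abs_torus z = abs_torus (x + s *\<^sub>R stable_vector A) \<and>
     abs_torus z = abs_torus (x + t *\<^sub>R unstable_vector A) \<and>
     \<bar>stable_eigenvalue A\<bar> ^ n * \<bar>s\<bar> < \<epsilon> \<and>
     \<bar>t\<bar> / \<bar>unstable_eigenvalue A\<bar> ^ n < \<epsilon>}"

definition asymptotic_topology :: "real \<Rightarrow> int^2^2 \<Rightarrow> (torus \<times> torus) topology" where
  "asymptotic_topology \<epsilon> A = topology (\<lambda>U. U \<subseteq> asymptotic_groupoid A \<and>
     (\<forall>n. openin (top_of_set (asymptotic_piece \<epsilon> A n)) (U \<inter> asymptotic_piece \<epsilon> A n)))"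

lemma openin_asymptotic_topology:
  "openin (asymptotic_topology \<epsilon> A) U \<longleftrightarrow> U \<subseteq> asymptotic_groupoid A \<and>
     (\<forall>n. openin (top_of_set (asymptotic_piece \<epsilon> A n)) (U \<inter> asymptotic_piece \<epsilon> A n))"
proof -
  let ?P = "asymptotic_piece \<epsilon> A"
  have "istopology (\<lambda>U. U \<subseteq> asymptotic_groupoid A \<and> (\<forall>n. openin (top_of_set (?P n)) (U \<inter> ?P n)))"
    unfolding istopology_def
  proof (intro conjI allI impI)
    fix S T n
    assume "S \<subseteq> asymptotic_groupoid A \<and> (\<forall>n. openin (top_of_set (?P n)) (S \<inter> ?P n))"
      and "T \<subseteq> asymptotic_groupoid A \<and> (\<forall>n. openin (top_of_set (?P n)) (T \<inter> ?P n))"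
    then have "openin (top_of_set (?P n)) ((S \<inter> ?P n) \<inter> (T \<inter> ?P n))" by blast
    then show "openin (top_of_set (?P n)) (S \<inter> T \<inter> ?P n)"
      by (simp add: Int_ac)
  next
    fix \<K> n
    assume "\<forall>K\<in>\<K>. K \<subseteq> asymptotic_groupoid A \<and> (\<forall>n. openin (top_of_set (?P n)) (K \<inter> ?P n))"
    then have "openin (top_of_set (?P n)) (\<Union>K\<in>\<K>. K \<inter> ?P n)" by blast
    then show "openin (top_of_set (?P n)) (\<Union>\<K> \<inter> ?P n)"
      by (simp only: Int_Union2)
  qed blast+
  then show ?thesis by (simp only: asymptotic_topology_def topology_inverse')
qed


section \<open>C*-algebras as structures\<close>

record 'a cstar_algebra = "(complex, 'a) module" +
  star :: "'a \<Rightarrow> 'a"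
  cnorm :: "'a \<Rightarrow> real"

definition cstar_iso :: "'a cstar_algebra \<Rightarrow> 'b cstar_algebra \<Rightarrow> ('a \<Rightarrow> 'b) set" where
  "cstar_iso C D = {\<phi> \<in> ring_iso C D. \<forall>a\<in>carrier C.
     (\<forall>c. \<phi> (c \<odot>\<^bsub>C\<^esub> a) = c \<odot>\<^bsub>D\<^esub> \<phi> a) \<and>
     \<phi> (star C a) = star D (\<phi> a) \<and>
     cnorm D (\<phi> a) = cnorm C a}"

definition cstar_isomorphic :: "'a cstar_algebra \<Rightarrow> 'b cstar_algebra \<Rightarrow> bool" where
  "cstar_isomorphic C D \<longleftrightarrow> cstar_iso C D \<noteq> {}"

text \<open>All algebras in question are unital, so a state is a positive unital functional.\<close>

definition tracial_state :: "'a cstar_algebra \<Rightarrow> ('a \<Rightarrow> complex) \<Rightarrow> bool" where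
  "tracial_state C \<tau> \<longleftrightarrow>
     (\<forall>a\<in>carrier C. \<forall>b\<in>carrier C. \<tau> (a \<oplus>\<^bsub>C\<^esub> b) = \<tau> a + \<tau> b) \<and>
     (\<forall>c. \<forall>a\<in>carrier C. \<tau> (c \<odot>\<^bsub>C\<^esub> a) = c * \<tau> a) \<and>
     (\<forall>a\<in>carrier C. \<tau> (star C a \<otimes>\<^bsub>C\<^esub> a) \<in> \<real>\<^sub>\<ge>\<^sub>0) \<and>
     \<tau> \<one>\<^bsub>C\<^esub> = 1 \<and>
     (\<forall>a\<in>carrier C. \<forall>b\<in>carrier C. \<tau> (a \<otimes>\<^bsub>C\<^esub> b) = \<tau> (b \<otimes>\<^bsub>C\<^esub> a))"

definition unique_tracial_state :: "'a cstar_algebra \<Rightarrow> ('a \<Rightarrow> complex) \<Rightarrow> bool" where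
  "unique_tracial_state C \<tau> \<longleftrightarrow> tracial_state C \<tau> \<and>
     (\<forall>\<tau>'. tracial_state C \<tau>' \<longrightarrow> (\<forall>a\<in>carrier C. \<tau>' a = \<tau> a))"


section \<open>K-theory of a unital C*-algebra\<close>

definition mats :: "'a cstar_algebra \<Rightarrow> nat \<Rightarrow> nat \<Rightarrow> (nat \<times> nat \<Rightarrow> 'a) set" where
  "mats C m n = ({..<m} \<times> {..<n}) \<rightarrow>\<^sub>E carrier C"

definition mat_mult ::
  "'a cstar_algebra \<Rightarrow> nat \<Rightarrow> nat \<Rightarrow> nat \<Rightarrow> (nat \<times> nat \<Rightarrow> 'a) \<Rightarrow> (nat \<times> nat \<Rightarrow> 'a) \<Rightarrow> nat \<times> nat \<Rightarrow> 'a"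
  where
  "mat_mult C l m n a b = (\<lambda>(i, j)\<in>{..<l} \<times> {..<n}.
     foldr (\<oplus>\<^bsub>C\<^esub>) (map (\<lambda>k. a (i, k) \<otimes>\<^bsub>C\<^esub> b (k, j)) [0..<m]) \<zero>\<^bsub>C\<^esub>)"

definition mat_star ::
  "'a cstar_algebra \<Rightarrow> nat \<Rightarrow> nat \<Rightarrow> (nat \<times> nat \<Rightarrow> 'a) \<Rightarrow> nat \<times> nat \<Rightarrow> 'a" where
  "mat_star C m n a = (\<lambda>(i, j)\<in>{..<n} \<times> {..<m}. star C (a (j, i)))"

definition projections :: "'a cstar_algebra \<Rightarrow> (nat \<times> (nat \<times> nat \<Rightarrow> 'a)) set" where
  "projections C = {(n, p). p \<in> mats C n n \<and> mat_mult C n n n p p = p \<and> mat_star C n n p = p}"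

definition murray_von_neumann ::
  "'a cstar_algebra \<Rightarrow> ((nat \<times> (nat \<times> nat \<Rightarrow> 'a)) \<times> (nat \<times> (nat \<times> nat \<Rightarrow> 'a))) set" where
  "murray_von_neumann C = {((n, p), (m, q)).
     (n, p) \<in> projections C \<and> (m, q) \<in> projections C \<and>
     (\<exists>v\<in>mats C m n. mat_mult C n m n (mat_star C m n v) v = p \<and>
                     mat_mult C m n m v (mat_star C m n v) = q)}"

fun diag_sum ::
  "'a cstar_algebra \<Rightarrow> nat \<times> (nat \<times> nat \<Rightarrow> 'a) \<Rightarrow> nat \<times> (nat \<times> nat \<Rightarrow> 'a) \<Rightarrow> nat \<times> (nat \<times> nat \<Rightarrow> 'a)"
  where
  "diag_sum C (n, p) (m, q) = (n + m, \<lambda>(i, j)\<in>{..<n + m} \<times> {..<n + m}.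
     if i < n \<and> j < n then p (i, j)
     else if n \<le> i \<and> n \<le> j then q (i - n, j - n)
     else \<zero>\<^bsub>C\<^esub>)"

definition projection_monoid :: "'a cstar_algebra \<Rightarrow> (nat \<times> (nat \<times> nat \<Rightarrow> 'a)) set monoid" where
  "projection_monoid C = \<lparr>
     carrier = projections C // murray_von_neumann C,
     monoid.mult = (\<lambda>X Y. \<Union>p\<in>X. \<Union>q\<in>Y. murray_von_neumann C `` {diag_sum C p q}),
     one = murray_von_neumann C `` {(0, \<lambda>_. undefined)}\<rparr>"

definition grothendieck_rel :: "('a, 'm) monoid_scheme \<Rightarrow> (('a \<times> 'a) \<times> ('a \<times> 'a)) set" where
  "grothendieck_rel M = {((a, b), (c, d)).
     a \<in> carrier M \<and> b \<in> carrier M \<and> c \<in> carrier M \<and> d \<in> carrier M \<and>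
     (\<exists>e\<in>carrier M. a \<otimes>\<^bsub>M\<^esub> d \<otimes>\<^bsub>M\<^esub> e = c \<otimes>\<^bsub>M\<^esub> b \<otimes>\<^bsub>M\<^esub> e)}"

definition grothendieck_group :: "('a, 'm) monoid_scheme \<Rightarrow> ('a \<times> 'a) set monoid" where
  "grothendieck_group M = \<lparr>
     carrier = (carrier M \<times> carrier M) // grothendieck_rel M,
     monoid.mult = (\<lambda>X Y. \<Union>(a, b)\<in>X. \<Union>(c, d)\<in>Y. grothendieck_rel M `` {(a \<otimes>\<^bsub>M\<^esub> c, b \<otimes>\<^bsub>M\<^esub> d)}),
     one = grothendieck_rel M `` {(\<one>\<^bsub>M\<^esub>, \<one>\<^bsub>M\<^esub>)}\<rparr>"

definition K0 :: "'a cstar_algebra \<Rightarrow>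
    ((nat \<times> (nat \<times> nat \<Rightarrow> 'a)) set \<times> (nat \<times> (nat \<times> nat \<Rightarrow> 'a)) set) set monoid" where
  "K0 C = grothendieck_group (projection_monoid C)"

text \<open>A trace is constant on Murray--von Neumann classes, and the induced monoid homomorphism
  is compatible with the Grothendieck relation; \<^const>\<open>the_elem\<close> picks the common value.\<close>

definition trace_projection :: "('a \<Rightarrow> complex) \<Rightarrow> nat \<times> (nat \<times> nat \<Rightarrow> 'a) \<Rightarrow> real" where
  "trace_projection \<tau> = (\<lambda>(n, p). Re (\<Sum>i<n. \<tau> (p (i, i))))"

definition trace_class :: "('a \<Rightarrow> complex) \<Rightarrow> (nat \<times> (nat \<times> nat \<Rightarrow> 'a)) set \<Rightarrow> real" where
  "trace_class \<tau> X = the_elem (trace_projection \<tau> ` X)"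

definition trace_K0 :: "('a \<Rightarrow> complex) \<Rightarrow>
    ((nat \<times> (nat \<times> nat \<Rightarrow> 'a)) set \<times> (nat \<times> (nat \<times> nat \<Rightarrow> 'a)) set) set \<Rightarrow> real" where
  "trace_K0 \<tau> Z = the_elem ((\<lambda>(X, Y). trace_class \<tau> X - trace_class \<tau> Y) ` Z)"


section \<open>The full C*-algebra of an etale equivalence relation with compact unit space\<close>

text \<open>The equivalence relation \<open>topspace T\<close> is a groupoid with product \<open>(x, y) (y, z) = (x, z)\<close>
  and inverse \<open>(x, z) \<mapsto> (z, x)\<close>. Functions on it are extended by zero. For etale \<open>T\<close> the sum
  in the convolution is finite.\<close>

definition Cc :: "('x \<times> 'x) topology \<Rightarrow> ('x \<times> 'x \<Rightarrow> complex) set" where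
  "Cc T = {f. continuous_map T euclidean f \<and> (\<forall>g. g \<notin> topspace T \<longrightarrow> f g = 0) \<and>
     compactin T (T closure_of {g. f g \<noteq> 0})}"

definition convolution :: "('x \<times> 'x \<Rightarrow> complex) \<Rightarrow> ('x \<times> 'x \<Rightarrow> complex) \<Rightarrow> 'x \<times> 'x \<Rightarrow> complex" where
  "convolution f g = (\<lambda>(x, z). \<Sum>y | f (x, y) * g (y, z) \<noteq> 0. f (x, y) * g (y, z))"

definition involution :: "('x \<times> 'x \<Rightarrow> complex) \<Rightarrow> 'x \<times> 'x \<Rightarrow> complex" where
  "involution f = (\<lambda>(x, z). cnj (f (z, x)))"

definition unit_function :: "('x \<times> 'x) topology \<Rightarrow> 'x \<times> 'x \<Rightarrow> complex" where
  "unit_function T = (\<lambda>(x, z). if (x, z) \<in> topspace T \<and> x = z then 1 else 0)"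

text \<open>The Hilbert space of square-summable functions on a set of indices (here, a type).\<close>

definition ell2 :: "('i \<Rightarrow> complex) set" where
  "ell2 = {\<xi>. (\<lambda>i. (cmod (\<xi> i))\<^sup>2) summable_on UNIV}"

definition ell2_inner :: "('i \<Rightarrow> complex) \<Rightarrow> ('i \<Rightarrow> complex) \<Rightarrow> complex" where
  "ell2_inner \<xi> \<eta> = (\<Sum>\<^sub>\<infinity>i. cnj (\<xi> i) * \<eta> i)"

definition ell2_norm :: "('i \<Rightarrow> complex) \<Rightarrow> real" where
  "ell2_norm \<xi> = sqrt (\<Sum>\<^sub>\<infinity>i. (cmod (\<xi> i))\<^sup>2)"

definition bounded_operator :: "(('i \<Rightarrow> complex) \<Rightarrow> 'i \<Rightarrow> complex) \<Rightarrow> bool" where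
  "bounded_operator t \<longleftrightarrow>
     (\<forall>\<xi>\<in>ell2. t \<xi> \<in> ell2) \<and>
     (\<forall>\<xi>\<in>ell2. \<forall>\<eta>\<in>ell2. t (\<lambda>i. \<xi> i + \<eta> i) = (\<lambda>i. t \<xi> i + t \<eta> i)) \<and>
     (\<forall>c. \<forall>\<xi>\<in>ell2. t (\<lambda>i. c * \<xi> i) = (\<lambda>i. c * t \<xi> i)) \<and>
     (\<exists>K. \<forall>\<xi>\<in>ell2. ell2_norm (t \<xi>) \<le> K * ell2_norm \<xi>)"

definition operator_norm :: "(('i \<Rightarrow> complex) \<Rightarrow> 'i \<Rightarrow> complex) \<Rightarrow> real" where
  "operator_norm t = (SUP \<xi>\<in>{\<xi>\<in>ell2. ell2_norm \<xi> \<le> 1}. ell2_norm (t \<xi>))"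

definition star_representation ::
  "('x \<times> 'x) topology \<Rightarrow> (('x \<times> 'x \<Rightarrow> complex) \<Rightarrow> ('i \<Rightarrow> complex) \<Rightarrow> 'i \<Rightarrow> complex) \<Rightarrow> bool" where
  "star_representation T \<pi> \<longleftrightarrow>
     (\<forall>f\<in>Cc T. bounded_operator (\<pi> f)) \<and>
     (\<forall>f\<in>Cc T. \<forall>g\<in>Cc T. \<forall>\<xi>\<in>ell2. \<pi> (\<lambda>x. f x + g x) \<xi> = (\<lambda>i. \<pi> f \<xi> i + \<pi> g \<xi> i)) \<and>
     (\<forall>c. \<forall>f\<in>Cc T. \<forall>\<xi>\<in>ell2. \<pi> (\<lambda>x. c * f x) \<xi> = (\<lambda>i. c * \<pi> f \<xi> i)) \<and>
     (\<forall>f\<in>Cc T. \<forall>g\<in>Cc T. \<forall>\<xi>\<in>ell2. \<pi> (convolution f g) \<xi> = \<pi> f (\<pi> g \<xi>)) \<and>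
     (\<forall>f\<in>Cc T. \<forall>\<xi>\<in>ell2. \<forall>\<eta>\<in>ell2. ell2_inner (\<pi> (involution f) \<xi>) \<eta> = ell2_inner \<xi> (\<pi> f \<eta>))"

text \<open>The norm of the full groupoid C*-algebra is the supremum over all *-representations on Hilbert
  spaces. It suffices to use one Hilbert space whose dimension is at least the cardinality of
  \<open>Cc T\<close>: cyclic representations determine the supremum, each of these has a dense
  subspace of the form \<open>\<pi> (Cc T) \<xi>\<close>, and representations may be degenerate. The index type
  of the Hilbert space below is the type of functions containing \<open>Cc T\<close>.\<close>

definition full_norm :: "('x \<times> 'x) topology \<Rightarrow> ('x \<times> 'x \<Rightarrow> complex) \<Rightarrow> real" where
  "full_norm T f = Sup {operator_norm (\<pi> f) | \<pi> ::
     ('x \<times> 'x \<Rightarrow> complex) \<Rightarrow> (('x \<times> 'x \<Rightarrow> complex) \<Rightarrow> complex) \<Rightarrow> ('x \<times> 'x \<Rightarrow> complex) \<Rightarrow> complex.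
     star_representation T \<pi>}"

text \<open>The completion consists of classes of Cauchy sequences modulo null sequences. The operations
  on classes are given by arbitrary representatives.\<close>

definition cauchy_seqs :: "('x \<times> 'x) topology \<Rightarrow> (nat \<Rightarrow> 'x \<times> 'x \<Rightarrow> complex) set" where
  "cauchy_seqs T = {s. (\<forall>n. s n \<in> Cc T) \<and>
     (\<forall>e>0. \<exists>N. \<forall>m\<ge>N. \<forall>n\<ge>N. full_norm T (\<lambda>x. s m x - s n x) < e)}"

definition null_rel ::
  "('x \<times> 'x) topology \<Rightarrow> ((nat \<Rightarrow> 'x \<times> 'x \<Rightarrow> complex) \<times> (nat \<Rightarrow> 'x \<times> 'x \<Rightarrow> complex)) set" where
  "null_rel T = {(s, t). s \<in> cauchy_seqs T \<and> t \<in> cauchy_seqs T \<and>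
     (\<lambda>n. full_norm T (\<lambda>x. s n x - t n x)) \<longlonglongrightarrow> 0}"

definition groupoid_cstar ::
  "('x \<times> 'x) topology \<Rightarrow> (nat \<Rightarrow> 'x \<times> 'x \<Rightarrow> complex) set cstar_algebra" where
  "groupoid_cstar T = \<lparr>
     carrier = cauchy_seqs T // null_rel T,
     monoid.mult = (\<lambda>X Y. \<Union>s\<in>X. \<Union>t\<in>Y. null_rel T `` {\<lambda>n. convolution (s n) (t n)}),
     one = null_rel T `` {\<lambda>n. unit_function T},
     zero = null_rel T `` {\<lambda>n x. 0},
     add = (\<lambda>X Y. \<Union>s\<in>X. \<Union>t\<in>Y. null_rel T `` {\<lambda>n x. s n x + t n x}),
     smult = (\<lambda>c X. \<Union>s\<in>X. null_rel T `` {\<lambda>n x. c * s n x}),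
     star = (\<lambda>X. \<Union>s\<in>X. null_rel T `` {\<lambda>n. involution (s n)}),
     cnorm = (\<lambda>X. the_elem ((\<lambda>s. lim (\<lambda>n. full_norm T (s n))) ` X))\<rparr>"

definition asymptotic_cstar ::
  "real \<Rightarrow> int^2^2 \<Rightarrow> (nat \<Rightarrow> torus \<times> torus \<Rightarrow> complex) set cstar_algebra" where
  "asymptotic_cstar \<epsilon> A = groupoid_cstar (asymptotic_topology \<epsilon> A)"

end

theory Submission
  imports Defs
begin

text \<open>A homeomorphism \<open>h\<close> of the torus that conjugates \<open>A\<close> to \<open>B\<close> maps asymptotic pairs to
  asymptotic pairs, and so does the identity for \<open>B = A\<^sup>-\<^sup>1\<close>. It is compatible with the inductive
  limit topologies because the pieces have a purely dynamical description: by uniform contraction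
  along the leaves, the pairs in a given piece are uniformly close at all times of modulus at least
  some \<open>N\<close>; conversely, by expansivity, pairs that are \<open>\<delta>\<close>-close at all these times lie in one
  piece, if \<open>\<delta>\<close> is small. Uniform continuity of \<open>h\<close> then maps pieces into pieces. Hence the
  groupoids are isomorphic as topological groupoids, and the isomorphism carries over to the
  C*-algebras, their \<open>K\<^sub>0\<close>-groups and, by uniqueness, their traces.\<close>


section \<open>Transport of K-theory along an isomorphism\<close>

text \<open>The domain on which entrywise transport is injective: off its index square an array is
  fixed to \<open>undefined\<close>. Entries are not restricted to the carrier, so
  \<open>diag_sum\<close> always lands here.\<close>

definition square_arrays :: "(nat \<times> (nat \<times> nat \<Rightarrow> 'a)) set" where
  "square_arrays = Sigma UNIV (\<lambda>n. extensional ({..<n} \<times> {..<n}))"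

lemma projections_subset_square_arrays: "projections C \<subseteq> square_arrays"
  by (auto simp: projections_def square_arrays_def mats_def PiE_def)

lemma diag_sum_in_square_arrays: "diag_sum C p q \<in> square_arrays"
  by (cases p; cases q) (auto simp: square_arrays_def)

lemma murray_von_neumann_subset: "murray_von_neumann C \<subseteq> projections C \<times> projections C"
  by (auto simp: murray_von_neumann_def)

text \<open>An image pair starting at \<open>f x\<close> can only come from a pair starting at
  \<open>x\<close>, because \<open>f\<close> is injective where first components live. At each level
  of the K-theory construction this turns classes over \<open>D\<close> into images of classes over
  \<open>C\<close>.\<close>

lemma Image_map_prod_singleton:
  assumes "inj_on f E" "R \<subseteq> E \<times> E'" "x \<in> E"
  shows "(map_prod f g ` R) `` {f x} = g ` (R `` {x})"
proof
  show "(map_prod f g ` R) `` {f x} \<subseteq> g ` (R `` {x})"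
  proof
    fix y assume "y \<in> (map_prod f g ` R) `` {f x}"
    then obtain a b where ab: "(a, b) \<in> R" "f x = f a" "y = g b" by auto
    then have "a = x" using assms by (auto dest: inj_onD)
    then show "y \<in> g ` (R `` {x})" using ab by auto
  qed
qed force

lemma quotient_map_prod:
  assumes "inj_on f E" "R \<subseteq> E \<times> E" "A \<subseteq> E"
  shows "(f ` A) // (map_prod f f ` R) = (`) f ` (A // R)"
proof -
  have "(map_prod f f ` R) `` {f x} = f ` (R `` {x})" if "x \<in> A" for x
    by (rule Image_map_prod_singleton[OF assms(1,2)]) (use that assms(3) in auto)
  then show ?thesis by (simp add: quotient_def image_UN)
qed

text \<open>The map is assumed to be compatible with the operations on the whole type, not just on the
  carrier. Then structures built from the operations can be transported without knowing that the
  operations preserve the carrier.\<close>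

locale cstar_transport =
  fixes C :: "'a cstar_algebra" and D :: "'b cstar_algebra" and \<phi> :: "'a \<Rightarrow> 'b"
  assumes bij: "bij \<phi>"
    and carrier_eq: "carrier D = \<phi> ` carrier C"
    and mult_eq: "\<And>a b. \<phi> (a \<otimes>\<^bsub>C\<^esub> b) = \<phi> a \<otimes>\<^bsub>D\<^esub> \<phi> b"
    and add_eq: "\<And>a b. \<phi> (a \<oplus>\<^bsub>C\<^esub> b) = \<phi> a \<oplus>\<^bsub>D\<^esub> \<phi> b"
    and one_eq: "\<phi> \<one>\<^bsub>C\<^esub> = \<one>\<^bsub>D\<^esub>"
    and zero_eq: "\<phi> \<zero>\<^bsub>C\<^esub> = \<zero>\<^bsub>D\<^esub>"
    and smult_eq: "\<And>c a. \<phi> (c \<odot>\<^bsub>C\<^esub> a) = c \<odot>\<^bsub>D\<^esub> \<phi> a"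
    and star_eq: "\<And>a. \<phi> (star C a) = star D (\<phi> a)"
    and cnorm_eq: "\<And>a. cnorm D (\<phi> a) = cnorm C a"
begin

lemma inj: "inj \<phi>" using bij by (rule bij_is_inj)

lemma phi_eq_iff [simp]: "\<phi> a = \<phi> b \<longleftrightarrow> a = b"
  using inj by (rule inj_eq)

lemma phi_in_carrier_iff [simp]: "\<phi> a \<in> carrier D \<longleftrightarrow> a \<in> carrier C"
  by (auto simp: carrier_eq)

lemma isomorphic: "cstar_isomorphic C D"
proof -
  have "bij_betw \<phi> (carrier C) (carrier D)"
    using inj carrier_eq by (auto simp: bij_betw_def intro: inj_on_subset)
  then have "\<phi> \<in> cstar_iso C D"
    by (auto simp: cstar_iso_def ring_iso_def ring_hom_def mult_eq add_eq one_eq smult_eq star_eq cnorm_eq)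
  then show ?thesis by (auto simp: cstar_isomorphic_def)
qed

lemma tracial_state_pullback:
  assumes "tracial_state D \<tau>"
  shows "tracial_state C (\<tau> \<circ> \<phi>)"
  using assms
  by (auto simp: tracial_state_def carrier_eq mult_eq add_eq one_eq smult_eq star_eq)

text \<open>The restriction resets the values off the index rectangle to \<open>undefined\<close>,
  as \<open>mats D\<close> demands; plain composition would leave \<open>\<phi> undefined\<close>
  there.\<close>

definition map_array :: "nat \<Rightarrow> nat \<Rightarrow> (nat \<times> nat \<Rightarrow> 'a) \<Rightarrow> nat \<times> nat \<Rightarrow> 'b" where
  "map_array m n a = restrict (\<phi> \<circ> a) ({..<m} \<times> {..<n})"

lemma map_array_eq_iff:
  assumes "a \<in> extensional ({..<m} \<times> {..<n})" "b \<in> extensional ({..<m} \<times> {..<n})"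
  shows "map_array m n a = map_array m n b \<longleftrightarrow> a = b"
proof
  assume eq: "map_array m n a = map_array m n b"
  show "a = b"
  proof (rule extensionalityI[OF assms])
    fix x assume "x \<in> {..<m} \<times> {..<n}"
    then show "a x = b x" using fun_cong[OF eq, of x] by (simp add: map_array_def)
  qed
qed simp

lemma map_array_in_mats_iff:
  assumes "a \<in> extensional ({..<m} \<times> {..<n})"
  shows "map_array m n a \<in> mats D m n \<longleftrightarrow> a \<in> mats C m n"
  using assms by (auto simp: mats_def map_array_def PiE_iff)

lemma mats_eq: "mats D m n = map_array m n ` mats C m n"
proof
  show "mats D m n \<subseteq> map_array m n ` mats C m n"
  proof
    fix b assume b: "b \<in> mats D m n"
    let ?a = "restrict (inv_into UNIV \<phi> \<circ> b) ({..<m} \<times> {..<n})"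
    have eq: "map_array m n ?a = b"
      using b bij by (auto simp: map_array_def mats_def fun_eq_iff bij_is_surj surj_f_inv_f PiE_iff
          extensional_def restrict_def)
    have "?a \<in> mats C m n"
      using b map_array_in_mats_iff[of ?a m n] unfolding eq by simp
    then show "b \<in> map_array m n ` mats C m n" using eq by force
  qed
  show "map_array m n ` mats C m n \<subseteq> mats D m n"
    using map_array_in_mats_iff by (fastforce simp: mats_def PiE_def)
qed

lemma foldr_add:
  "\<phi> (foldr (\<oplus>\<^bsub>C\<^esub>) xs \<zero>\<^bsub>C\<^esub>) = foldr (\<oplus>\<^bsub>D\<^esub>) (map \<phi> xs) \<zero>\<^bsub>D\<^esub>"
  by (induction xs) (simp_all add: zero_eq add_eq)

text \<open>Entries are folds of sums of products, and \<phi> respects both operations on the whole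
  type, so the arrays may be arbitrary.\<close>

lemma mat_mult_map_array:
  "mat_mult D l m n (map_array l m a) (map_array m n b) = map_array l n (mat_mult C l m n a b)"
proof (rule ext)
  fix x :: "nat \<times> nat"
  obtain i j where x: "x = (i, j)" by (cases x)
  have "map (\<lambda>k. map_array l m a (i, k) \<otimes>\<^bsub>D\<^esub> map_array m n b (k, j)) [0..<m] =
      map \<phi> (map (\<lambda>k. a (i, k) \<otimes>\<^bsub>C\<^esub> b (k, j)) [0..<m])" if "i < l" "j < n"
    using that by (simp add: map_array_def mult_eq)
  then show "mat_mult D l m n (map_array l m a) (map_array m n b) x =
      map_array l n (mat_mult C l m n a b) x"
    by (cases "i < l \<and> j < n")
      (auto simp: x mat_mult_def map_array_def[of l n] foldr_add simp del: map_map)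
qed

lemma mat_star_map_array: "mat_star D m n (map_array m n a) = map_array n m (mat_star C m n a)"
proof (rule ext)
  fix x :: "nat \<times> nat"
  show "mat_star D m n (map_array m n a) x = map_array n m (mat_star C m n a) x"
    by (cases x) (simp add: mat_star_def map_array_def star_eq)
qed

lemma extensional_ops [simp]:
  "mat_mult C l m n a b \<in> extensional ({..<l} \<times> {..<n})"
  "mat_star C m n a \<in> extensional ({..<n} \<times> {..<m})"
  by (simp_all add: mat_mult_def mat_star_def)

section \<open>Projections and Murray-von Neumann equivalence\<close>

definition map_square :: "nat \<times> (nat \<times> nat \<Rightarrow> 'a) \<Rightarrow> nat \<times> (nat \<times> nat \<Rightarrow> 'b)" where
  "map_square = (\<lambda>(n, p). (n, map_array n n p))"

lemma inj_on_map_square: "inj_on map_square square_arrays"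
  by (rule inj_onI) (auto simp: map_square_def square_arrays_def map_array_eq_iff)

lemma map_square_in_projections_iff:
  assumes "x \<in> square_arrays"
  shows "map_square x \<in> projections D \<longleftrightarrow> x \<in> projections C"
proof -
  obtain n p where x: "x = (n, p)" by (cases x)
  then have "p \<in> extensional ({..<n} \<times> {..<n})" using assms by (simp add: square_arrays_def)
  then show ?thesis
    by (simp add: x map_square_def projections_def map_array_in_mats_iff mat_mult_map_array
        mat_star_map_array map_array_eq_iff)
qed

lemma projections_eq: "projections D = map_square ` projections C"
proof
  show "projections D \<subseteq> map_square ` projections C"
  proof
    fix y assume y: "y \<in> projections D"
    obtain n q where yq: "y = (n, q)" by (cases y)
    then have "q \<in> map_array n n ` mats C n n"
      using y by (simp add: projections_def flip: mats_eq)
    then obtain p where p: "p \<in> mats C n n" "q = map_array n n p" by auto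
    then have "y = map_square (n, p)" "(n, p) \<in> square_arrays"
      by (auto simp: yq map_square_def square_arrays_def mats_def PiE_def)
    then show "y \<in> map_square ` projections C"
      using y map_square_in_projections_iff by blast
  qed
  show "map_square ` projections C \<subseteq> projections D"
    using map_square_in_projections_iff projections_subset_square_arrays by blast
qed

text \<open>By \<open>mats_eq\<close> every candidate partial isometry over \<open>D\<close> is the
  entrywise image of one over \<open>C\<close>, and its two equations can be read back over
  \<open>C\<close> because \<open>map_array\<close> is injective on extensional arrays.\<close>

lemma map_square_murray_von_neumann_iff:
  assumes "x \<in> projections C" "y \<in> projections C"
  shows "(map_square x, map_square y) \<in> murray_von_neumann D \<longleftrightarrow> (x, y) \<in> murray_von_neumann C"
proof -
  obtain n p m q where xy: "x = (n, p)" "y = (m, q)" by (cases x; cases y)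
  have ext: "p \<in> extensional ({..<n} \<times> {..<n})" "q \<in> extensional ({..<m} \<times> {..<m})"
    using assms by (auto simp: xy projections_def mats_def PiE_def)
  have "(n, map_array n n p) \<in> projections D" "(m, map_array m m q) \<in> projections D"
    using assms by (auto simp: projections_eq xy map_square_def)
  then show ?thesis
    using assms
    by (simp add: xy map_square_def murray_von_neumann_def mats_eq mat_mult_map_array
        mat_star_map_array map_array_eq_iff ext)
qed

lemma murray_von_neumann_eq:
  "murray_von_neumann D = map_prod map_square map_square ` murray_von_neumann C"
proof -
  have "(u, v) \<in> murray_von_neumann D \<longleftrightarrow> (u, v) \<in> map_prod map_square map_square ` murray_von_neumann C"
    for u v
  proof
    assume uv: "(u, v) \<in> murray_von_neumann D"
    then have "u \<in> map_square ` projections C" "v \<in> map_square ` projections C"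
      using murray_von_neumann_subset[of D] projections_eq by auto
    then show "(u, v) \<in> map_prod map_square map_square ` murray_von_neumann C"
      using uv map_square_murray_von_neumann_iff by force
  next
    assume "(u, v) \<in> map_prod map_square map_square ` murray_von_neumann C"
    then obtain x y where "(x, y) \<in> murray_von_neumann C" "u = map_square x" "v = map_square y"
      by auto
    then show "(u, v) \<in> murray_von_neumann D"
      using murray_von_neumann_subset[of C] map_square_murray_von_neumann_iff by blast
  qed
  then show ?thesis by (intro equalityI subrelI) simp_all
qed

lemma diag_sum_map_square:
  "diag_sum D (map_square x) (map_square y) = map_square (diag_sum C x y)"
proof -
  obtain n p m q where xy: "x = (n, p)" "y = (m, q)" by (cases x; cases y)
  have "snd (diag_sum D (map_square x) (map_square y)) z = snd (map_square (diag_sum C x y)) z" for z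
    by (cases z) (auto simp: xy map_square_def map_array_def zero_eq)
  moreover have "fst (diag_sum D (map_square x) (map_square y)) = fst (map_square (diag_sum C x y))"
    by (simp add: xy map_square_def)
  ultimately show ?thesis by (intro prod_eqI ext)
qed

text \<open>If \<open>x\<close> is not a projection, both sides are empty. Admitting such
  \<open>x\<close> lets the lemma apply to every \<open>diag_sum C p q\<close>.\<close>

lemma murray_von_neumann_Image:
  assumes "x \<in> square_arrays"
  shows "murray_von_neumann D `` {map_square x} = map_square ` (murray_von_neumann C `` {x})"
  unfolding murray_von_neumann_eq
  by (rule Image_map_prod_singleton[OF inj_on_map_square _ assms])
    (use murray_von_neumann_subset projections_subset_square_arrays in blast)

section \<open>The projection monoid, its Grothendieck group and traces\<close>

abbreviation "MC \<equiv> projection_monoid C"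
abbreviation "MD \<equiv> projection_monoid D"

text \<open>Holds for all sets \<open>X\<close> and \<open>Y\<close>, since \<open>diag_sum\<close>
  commutes with \<open>map_square\<close> exactly and not just up to equivalence.\<close>

lemma mult_projection_monoid:
  "map_square ` X \<otimes>\<^bsub>MD\<^esub> map_square ` Y = map_square ` (X \<otimes>\<^bsub>MC\<^esub> Y)"
  by (simp add: projection_monoid_def diag_sum_map_square image_UN
      murray_von_neumann_Image[OF diag_sum_in_square_arrays])

lemma carrier_projection_monoid_eq: "carrier MD = (`) map_square ` carrier MC"
  unfolding projection_monoid_def partial_object.simps projections_eq murray_von_neumann_eq
  by (rule quotient_map_prod[OF inj_on_map_square])
    (use murray_von_neumann_subset projections_subset_square_arrays in blast)+

text \<open>Keeps products inside the domain on which taking images under \<open>map_square\<close>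
  is injective, so that equations between products can be pulled back from \<open>MD\<close> to
  \<open>MC\<close>.\<close>

lemma mult_projection_monoid_subset: "X \<otimes>\<^bsub>MC\<^esub> Y \<subseteq> square_arrays"
  using murray_von_neumann_subset[of C] projections_subset_square_arrays[of C]
  by (fastforce simp: projection_monoid_def)

lemma carrier_projection_monoid_subset: "X \<in> carrier MC \<Longrightarrow> X \<subseteq> square_arrays"
  using murray_von_neumann_subset[of C] projections_subset_square_arrays[of C]
  by (auto simp: projection_monoid_def quotient_def)

lemma inj_on_image_map_square: "inj_on ((`) map_square) (Pow square_arrays)"
  using inj_on_map_square by (rule inj_on_image_Pow)

lemma grothendieck_rel_subset: "grothendieck_rel M \<subseteq> (carrier M \<times> carrier M) \<times> (carrier M \<times> carrier M)"
  by (auto simp: grothendieck_rel_def)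

abbreviation "map_pair \<equiv> map_prod ((`) map_square) ((`) map_square)"

text \<open>The stabilising element over \<open>D\<close> is itself an image, since the carrier of
  \<open>MD\<close> consists of images of classes over \<open>C\<close>. The image map is then
  cancelled from the defining equation.\<close>

lemma grothendieck_rel_eq:
  "grothendieck_rel MD = map_prod map_pair map_pair ` grothendieck_rel MC"
proof -
  let ?f = "(`) map_square"
  have *: "((?f a, ?f b), (?f c, ?f d)) \<in> grothendieck_rel MD \<longleftrightarrow> ((a, b), (c, d)) \<in> grothendieck_rel MC"
    if "a \<in> carrier MC" "b \<in> carrier MC" "c \<in> carrier MC" "d \<in> carrier MC" for a b c d
  proof -
    have "?f (a \<otimes>\<^bsub>MC\<^esub> d \<otimes>\<^bsub>MC\<^esub> e) = ?f (c \<otimes>\<^bsub>MC\<^esub> b \<otimes>\<^bsub>MC\<^esub> e) \<longleftrightarrow>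
        a \<otimes>\<^bsub>MC\<^esub> d \<otimes>\<^bsub>MC\<^esub> e = c \<otimes>\<^bsub>MC\<^esub> b \<otimes>\<^bsub>MC\<^esub> e" for e
      using mult_projection_monoid_subset by (intro inj_on_eq_iff[OF inj_on_image_map_square]) auto
    then show ?thesis
      using that by (simp add: grothendieck_rel_def carrier_projection_monoid_eq mult_projection_monoid)
  qed
  show ?thesis
  proof (intro equalityI subsetI)
    fix z assume z: "z \<in> grothendieck_rel MD"
    then have "z \<in> map_prod map_pair map_pair ` ((carrier MC \<times> carrier MC) \<times> (carrier MC \<times> carrier MC))"
      using grothendieck_rel_subset[of MD]
      by (fastforce simp: carrier_projection_monoid_eq map_prod_def image_iff)
    then obtain a b c d where "z = ((?f a, ?f b), (?f c, ?f d))"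
      "a \<in> carrier MC" "b \<in> carrier MC" "c \<in> carrier MC" "d \<in> carrier MC"
      by auto
    then show "z \<in> map_prod map_pair map_pair ` grothendieck_rel MC" using z *[of a b c d] by force
  next
    fix z assume "z \<in> map_prod map_pair map_pair ` grothendieck_rel MC"
    then obtain a b c d where z: "z = ((?f a, ?f b), (?f c, ?f d))" "((a, b), (c, d)) \<in> grothendieck_rel MC"
      by auto
    then show "z \<in> grothendieck_rel MD" using *[of a b c d] grothendieck_rel_subset[of MC] by auto
  qed
qed

text \<open>The argument for the carrier of the projection monoid, one level higher:
  \<open>map_pair\<close> is injective on pairs of subsets of \<open>square_arrays\<close>, and
  pairs of classes are of this kind.\<close>

lemma carrier_K0_eq: "carrier (K0 D) = (`) map_pair ` carrier (K0 C)"
proof -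
  have inj: "inj_on map_pair (Pow square_arrays \<times> Pow square_arrays)"
    using inj_on_image_map_square by (intro map_prod_inj_on)
  have sub: "carrier MC \<times> carrier MC \<subseteq> Pow square_arrays \<times> Pow square_arrays"
    using carrier_projection_monoid_subset by auto
  have "carrier MD \<times> carrier MD = map_pair ` (carrier MC \<times> carrier MC)"
    by (auto simp: carrier_projection_monoid_eq)
  moreover have "grothendieck_rel MC \<subseteq> (Pow square_arrays \<times> Pow square_arrays) \<times> (Pow square_arrays \<times> Pow square_arrays)"
    using grothendieck_rel_subset[of MC] sub by blast
  ultimately show ?thesis
    using quotient_map_prod[OF inj _ sub, of "grothendieck_rel MC"]
    by (simp only: K0_def grothendieck_group_def partial_object.simps grothendieck_rel_eq)
qed

text \<open>Agreement on the carrier suffices because diagonal entries of projections lie there. At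
  both upper levels \<open>the_elem\<close> is applied to the same set of numbers on the two sides,
  so the values agree.\<close>

lemma trace_K0_image_eq:
  assumes "\<And>a. a \<in> carrier C \<Longrightarrow> \<sigma> (\<phi> a) = \<tau> a"
  shows "trace_K0 \<sigma> ` carrier (K0 D) = trace_K0 \<tau> ` carrier (K0 C)"
proof -
  have "trace_projection \<sigma> (map_square x) = trace_projection \<tau> x" if "x \<in> projections C" for x
  proof -
    obtain n p where x: "x = (n, p)" by (cases x)
    then have "p (i, i) \<in> carrier C" if "i < n" for i
      using that \<open>x \<in> projections C\<close> by (auto simp: projections_def mats_def)
    then show ?thesis
      by (simp add: x trace_projection_def map_square_def map_array_def assms)
  qed
  moreover have "X \<subseteq> projections C" if "X \<in> carrier MC" for X
    using that murray_von_neumann_subset[of C] by (auto simp: projection_monoid_def quotient_def)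
  ultimately have "trace_class \<sigma> (map_square ` X) = trace_class \<tau> X" if "X \<in> carrier MC" for X
    using that unfolding trace_class_def image_image by (metis (no_types, lifting) image_cong subsetD)
  moreover have "Z \<subseteq> carrier MC \<times> carrier MC" if "Z \<in> carrier (K0 C)" for Z
    using that grothendieck_rel_subset[of MC]
    by (auto simp: K0_def grothendieck_group_def quotient_def)
  ultimately have "trace_K0 \<sigma> (map_pair ` Z) = trace_K0 \<tau> Z" if "Z \<in> carrier (K0 C)" for Z
    using that unfolding trace_K0_def image_image
    by (intro arg_cong[where f = the_elem] image_cong) (fastforce simp: case_prod_beta)+
  then show ?thesis by (simp add: carrier_K0_eq image_image)
qed

text \<open>The pullback of \<sigma> along \<phi> is a tracial state on \<open>C\<close>, hence
  equals \<tau> on the carrier by uniqueness.\<close>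

lemma unique_trace_K0_image_eq:
  assumes "unique_tracial_state C \<tau>" "unique_tracial_state D \<sigma>"
  shows "trace_K0 \<tau> ` carrier (K0 C) = trace_K0 \<sigma> ` carrier (K0 D)"
proof (rule trace_K0_image_eq[symmetric])
  fix a assume "a \<in> carrier C"
  moreover have "tracial_state C (\<sigma> \<circ> \<phi>)"
    using assms(2) tracial_state_pullback by (simp add: unique_tracial_state_def)
  ultimately show "\<sigma> (\<phi> a) = \<tau> a"
    using assms(1) by (simp add: unique_tracial_state_def)
qed

end

section \<open>Isomorphic groupoids\<close>

text \<open>Substitute the middle point \<open>y\<close> by \<open>k y\<close>. The substitution
  matches the sets of nonzero terms, so the identity survives even where such a set is infinite and
  the sum is 0 by convention.\<close>

lemma convolution_map_prod:
  fixes h k :: "'x \<Rightarrow> 'x"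
  assumes "\<And>x. k (h x) = x" "\<And>x. h (k x) = x"
  shows "convolution (f \<circ> map_prod k k) (g \<circ> map_prod k k) = convolution f g \<circ> map_prod k k"
proof (rule ext)
  fix p :: "'x \<times> 'x"
  obtain x z where p: "p = (x, z)" by (cases p)
  show "convolution (f \<circ> map_prod k k) (g \<circ> map_prod k k) p = (convolution f g \<circ> map_prod k k) p"
    unfolding p convolution_def comp_apply map_prod_simp prod.case
    by (rule sum.reindex_bij_witness[of _ h k]) (simp_all add: assms)
qed

text \<open>The closed support is carried to the closed support, which gives compactness. Since
  functions are extended by zero, \<open>k\<close> also has to send pairs off
  \<open>topspace S\<close> off \<open>topspace T\<close>; this is where bijectivity on the whole
  type enters.\<close>

lemma Cc_comp_homeomorphism:
  assumes hom: "homeomorphic_map S T (map_prod k k)" and bij: "bij k" and f: "f \<in> Cc T"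
  shows "f \<circ> map_prod k k \<in> Cc S"
proof -
  let ?K = "map_prod k k"
  let ?A = "{g. (f \<circ> ?K) g \<noteq> 0}"
  have K: "bij ?K" using bij by (simp add: bij_def prod.inj_map map_prod_surj)
  have top: "?K ` topspace S = topspace T" using hom by (rule homeomorphic_imp_surjective_map)
  have zero: "(f \<circ> ?K) g = 0" if "g \<notin> topspace S" for g
  proof -
    have "?K g \<notin> topspace T" using that K unfolding top[symmetric]
      by (simp add: inj_image_mem_iff bij_is_inj)
    then show ?thesis using f unfolding Cc_def mem_Collect_eq comp_apply by blast
  qed
  then have sub: "?A \<subseteq> topspace S" by blast
  have "?K ` ?A = {g. f g \<noteq> 0}"
    using surj_image_vimage_eq[OF bij_is_surj[OF K], of "{g. f g \<noteq> 0}"] by (simp add: vimage_def)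
  then have "compactin T (?K ` (S closure_of ?A))"
    using f homeomorphic_map_closure_of[OF hom sub] by (simp add: Cc_def)
  then have "compactin S (S closure_of ?A)"
    using homeomorphic_map_compactness[OF hom closure_of_subset_topspace] by blast
  moreover have "continuous_map S euclidean (f \<circ> ?K)"
    using f homeomorphic_imp_continuous_map[OF hom] by (auto simp: Cc_def intro: continuous_map_compose)
  ultimately show ?thesis using zero unfolding Cc_def mem_Collect_eq by blast
qed

text \<open>A map of the form \<open>map_prod h h\<close> respects the product and inverse of pairs
  automatically, so a homeomorphism of this shape is an isomorphism of topological
  groupoids.\<close>

locale groupoid_homeomorphism =
  fixes S T :: "('x \<times> 'x) topology" and h k :: "'x \<Rightarrow> 'x"
  assumes homs: "homeomorphic_maps S T (map_prod h h) (map_prod k k)"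
    and inv1 [simp]: "\<And>x. k (h x) = x"
    and inv2 [simp]: "\<And>x. h (k x) = x"
begin

lemma bij_h: "bij h" by (rule bijI'[of h]) (metis inv1 inv2)+
lemma bij_k: "bij k" by (rule bijI'[of k]) (metis inv1 inv2)+

lemma hom: "homeomorphic_map S T (map_prod h h)"
  and hom_inverse: "homeomorphic_map T S (map_prod k k)"
  using homs by (auto simp: homeomorphic_maps_map)

section \<open>Functions on the groupoid and their representations\<close>

definition transport :: "('x \<times> 'x \<Rightarrow> complex) \<Rightarrow> 'x \<times> 'x \<Rightarrow> complex" where
  "transport f = f \<circ> map_prod k k"

definition transport_inv :: "('x \<times> 'x \<Rightarrow> complex) \<Rightarrow> 'x \<times> 'x \<Rightarrow> complex" where
  "transport_inv f = f \<circ> map_prod h h"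

lemma transport_inverses [simp]:
  "transport (transport_inv f) = f" "transport_inv (transport f) = f"
  by (simp_all add: transport_def transport_inv_def fun_eq_iff)

lemma transport_eq_iff [simp]: "transport f = transport g \<longleftrightarrow> f = g"
  by (metis transport_inverses(2))

lemma transport_pointwise:
  "transport (\<lambda>x. f x + g x) = (\<lambda>x. transport f x + transport g x)"
  "transport (\<lambda>x. f x - g x) = (\<lambda>x. transport f x - transport g x)"
  "transport (\<lambda>x. c * f x) = (\<lambda>x. c * transport f x)"
  "transport (\<lambda>x. c) = (\<lambda>x. c)"
  by (simp_all add: transport_def fun_eq_iff)

lemma Cc_eq: "Cc T = transport ` Cc S"
proof
  show "transport ` Cc S \<subseteq> Cc T"
    using Cc_comp_homeomorphism[OF hom_inverse bij_k] by (auto simp: transport_def)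
  have "transport_inv f \<in> Cc S" if "f \<in> Cc T" for f
    using Cc_comp_homeomorphism[OF hom bij_h that] by (simp add: transport_inv_def)
  then show "Cc T \<subseteq> transport ` Cc S"
    by (metis image_iff subsetI transport_inverses(1))
qed

lemma transport_in_Cc_iff [simp]: "transport f \<in> Cc T \<longleftrightarrow> f \<in> Cc S"
  by (auto simp: Cc_eq)

lemma transport_convolution: "convolution (transport f) (transport g) = transport (convolution f g)"
  by (simp add: transport_def convolution_map_prod[of k h])

lemma transport_involution: "involution (transport f) = transport (involution f)"
  by (auto simp: transport_def involution_def fun_eq_iff)

lemma transport_unit: "unit_function T = transport (unit_function S)"
proof (rule ext)
  fix p :: "'x \<times> 'x"
  obtain x z where p: "p = (x, z)" by (cases p)
  have "(x, z) \<in> topspace T \<longleftrightarrow> (k x, k z) \<in> topspace S"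
  proof -
    have "topspace T = map_prod h h ` topspace S"
      using hom by (simp add: homeomorphic_imp_surjective_map)
    then show ?thesis by (force simp: image_iff)
  qed
  moreover have "k x = k z \<longleftrightarrow> x = z" by (metis inv2)
  ultimately show "unit_function T p = transport (unit_function S) p"
    by (simp add: p unit_function_def transport_def)
qed

lemma star_representation_transport:
  "star_representation S (\<pi> \<circ> transport) \<longleftrightarrow> star_representation T \<pi>"
  by (simp add: star_representation_def Cc_eq transport_pointwise transport_convolution
      transport_involution)

text \<open>Precomposition with \<open>transport\<close> matches the representations of
  \<open>Cc T\<close> with those of \<open>Cc S\<close> on the same Hilbert space, so both suprema
  run over the same set of operator norms.\<close>

lemma full_norm_transport: "full_norm T (transport f) = full_norm S f"
proof -
  let ?R = "\<lambda>T. {\<pi> :: ('x \<times> 'x \<Rightarrow> complex) \<Rightarrow> (('x \<times> 'x \<Rightarrow> complex) \<Rightarrow> complex) \<Rightarrow> ('x \<times> 'x \<Rightarrow> complex) \<Rightarrow> complex.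
    star_representation T \<pi>}"
  have "(\<lambda>\<pi>. operator_norm (\<pi> (transport f))) ` ?R T = (\<lambda>\<rho>. operator_norm (\<rho> f)) ` ?R S"
  proof (intro equalityI image_subsetI)
    fix \<pi> assume "\<pi> \<in> ?R T"
    then show "operator_norm (\<pi> (transport f)) \<in> (\<lambda>\<rho>. operator_norm (\<rho> f)) ` ?R S"
      by (intro image_eqI[of _ _ "\<pi> \<circ> transport"]) (simp_all add: star_representation_transport)
  next
    fix \<rho> assume "\<rho> \<in> ?R S"
    then have "star_representation S ((\<rho> \<circ> transport_inv) \<circ> transport)"
      by (simp add: comp_def)
    then show "operator_norm (\<rho> f) \<in> (\<lambda>\<pi>. operator_norm (\<pi> (transport f))) ` ?R T"
      by (intro image_eqI[of _ _ "\<rho> \<circ> transport_inv"]) (simp_all add: star_representation_transport)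
  qed
  then show ?thesis unfolding full_norm_def by (simp add: setcompr_eq_image)
qed

section \<open>The completion\<close>

definition transport_seq :: "(nat \<Rightarrow> 'x \<times> 'x \<Rightarrow> complex) \<Rightarrow> nat \<Rightarrow> 'x \<times> 'x \<Rightarrow> complex" where
  "transport_seq s = (\<lambda>n. transport (s n))"

lemma transport_seq_apply: "transport_seq s n = transport (s n)"
  by (simp add: transport_seq_def)

lemma bij_transport_seq: "bij transport_seq"
proof (rule bijI')
  show "transport_seq s = transport_seq t \<longleftrightarrow> s = t" for s t
    by (simp add: transport_seq_def fun_eq_iff[of s] fun_eq_iff[of "\<lambda>n. transport (s n)"])
  show "\<exists>s. t = transport_seq s" for t
    by (rule exI[of _ "\<lambda>n. transport_inv (t n)"]) (simp add: transport_seq_def)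
qed

lemma transport_seq_in_cauchy_seqs_iff: "transport_seq s \<in> cauchy_seqs T \<longleftrightarrow> s \<in> cauchy_seqs S"
  by (simp add: cauchy_seqs_def transport_seq_def flip: transport_pointwise full_norm_transport)

lemma cauchy_seqs_eq: "cauchy_seqs T = transport_seq ` cauchy_seqs S"
proof -
  have "transport_seq -` cauchy_seqs T = cauchy_seqs S"
    by (auto simp: transport_seq_in_cauchy_seqs_iff)
  then show ?thesis using surj_image_vimage_eq[OF bij_is_surj[OF bij_transport_seq]] by metis
qed

lemma null_rel_transport_iff: "(transport_seq s, transport_seq t) \<in> null_rel T \<longleftrightarrow> (s, t) \<in> null_rel S"
  by (simp add: null_rel_def transport_seq_in_cauchy_seqs_iff)
    (simp add: transport_seq_def flip: transport_pointwise full_norm_transport)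

lemma null_rel_Image: "null_rel T `` {transport_seq s} = transport_seq ` (null_rel S `` {s})"
proof (intro equalityI subsetI)
  fix t assume t: "t \<in> null_rel T `` {transport_seq s}"
  obtain t' where "t = transport_seq t'" using bij_is_surj[OF bij_transport_seq] by blast
  then show "t \<in> transport_seq ` (null_rel S `` {s})" using t null_rel_transport_iff by auto
qed (use null_rel_transport_iff in auto)

lemma groupoid_cstar_transport:
  "cstar_transport (groupoid_cstar S) (groupoid_cstar T) (image transport_seq)"
proof -
  \<comment> \<open>All operations except the norm are classes or unions of classes of
    representatives. This identity therefore transports them for arbitrary sets of sequences, as the
    locale requires.\<close>
  have class_eq: "transport_seq ` (null_rel S `` {s}) = null_rel T `` {\<lambda>n. transport (s n)}" for s
    using null_rel_Image[of s] by (simp add: transport_seq_def[of s])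
  show ?thesis
  proof
    show "bij (image transport_seq)" using bij_betw_image_Pow[OF bij_transport_seq] by simp
    show "carrier (groupoid_cstar T) = image transport_seq ` carrier (groupoid_cstar S)"
      by (auto simp: groupoid_cstar_def quotient_def cauchy_seqs_eq null_rel_Image)
  qed (simp_all add: groupoid_cstar_def image_UN class_eq transport_convolution transport_involution
      transport_pointwise transport_unit image_image full_norm_transport transport_seq_apply)
qed

end

section \<open>Hyperbolic toral automorphisms\<close>

text \<open>The torus is the image of the closed unit square under the quotient map, which does not
  increase distances. Compactness later makes a conjugacy uniformly continuous.\<close>

lemma compact_UNIV_torus: "compact (UNIV :: torus set)"
proof -
  have "continuous_on (cbox 0 1) abs_torus"
    unfolding continuous_on_iff using dist_torus_le by (metis dist_norm le_less_trans)
  then have "compact (abs_torus ` cbox 0 1)" by (intro compact_continuous_image) auto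
  moreover have "x \<in> abs_torus ` cbox 0 1" for x
  proof -
    obtain u where u: "x = abs_torus u" by (rule abs_torus_cases)
    let ?v = "\<chi> i. frac (u $ i)"
    have "abs_torus u = abs_torus ?v" by (simp add: abs_torus_eq_iff frac_def)
    moreover have "?v \<in> cbox 0 1"
      by (auto simp: mem_box_cart frac_ge_0 less_imp_le[OF frac_lt_1])
    ultimately show ?thesis using u by blast
  qed
  ultimately show ?thesis by (metis UNIV_eq_I)
qed

text \<open>Translations record the displacement between two torus points as a vector of the plane,
  where toral maps act linearly.\<close>

lift_definition shift :: "real^2 \<Rightarrow> torus \<Rightarrow> torus" is "\<lambda>c v. v + c"
  by simp

lemma shift_abs: "shift c (abs_torus v) = abs_torus (v + c)"
  by (rule shift.abs_eq)

lemma dist_shift_le: "dist x (shift c x) \<le> norm c"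
proof -
  obtain v where "x = abs_torus v" by (rule abs_torus_cases)
  then show ?thesis using dist_torus_le[of v "v + c"] by (simp add: shift_abs)
qed

lemma dist_less_shiftE:
  assumes "dist x y < e"
  obtains c where "y = shift c x" "norm c < e"
proof -
  obtain z w where "abs_torus z = x" "abs_torus w = y" "norm (z - w) < e"
    using assms by (rule dist_torus_lessE)
  then show thesis using that[of "w - z"] by (auto simp: shift_abs norm_minus_commute)
qed

text \<open>The difference of the two displacements is an integer vector with entries of modulus
  less than 1.\<close>

lemma shift_eq_imp_eq:
  assumes "shift c x = shift d x" "norm (c - d) < 1"
  shows "c = d"
proof -
  obtain v where "x = abs_torus v" by (rule abs_torus_cases)
  then have "c $ i - d $ i \<in> \<int>" for i
    using assms(1) by (simp add: shift_abs abs_torus_eq_iff)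
  moreover have "\<bar>c $ i - d $ i\<bar> < 1" for i
    using component_le_norm_cart[of "c - d" i] assms(2) by simp
  ultimately have "c $ i - d $ i = 0" for i
    by (metis Ints_nonzero_abs_less1)
  then show ?thesis by (simp add: vec_eq_iff)
qed

lemma torus_map_shift: "torus_map M (shift c x) = shift (real_matrix M *v c) (torus_map M x)"
  by transfer (simp add: matrix_vector_right_distrib)

lemma torus_map_pow_shift:
  "(torus_map M ^^ k) (shift c x) = shift (((*v) (real_matrix M) ^^ k) c) ((torus_map M ^^ k) x)"
  by (induction k) (simp_all add: torus_map_shift)

section \<open>Iterates and inverses along eigenvectors\<close>

lemma pow_eigenvector:
  fixes v :: "real^2"
  assumes "M *v v = l *s v"
  shows "((*v) M ^^ k) (c *s v) = (c * l ^ k) *s v"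
  by (induction k) (simp_all add: vector_scalar_commute assms mult_ac)

lemma pow_linear:
  fixes M :: "real^2^2"
  shows "((*v) M ^^ k) (v + w) = ((*v) M ^^ k) v + ((*v) M ^^ k) w"
  by (induction k) (simp_all add: matrix_vector_right_distrib)

lemma real_matrix_mult: "real_matrix (M ** N) = real_matrix M ** real_matrix N"
  by (simp add: vec_eq_iff matrix_matrix_mult_def)

lemma real_matrix_one: "real_matrix (mat 1) = mat 1"
  by (simp add: vec_eq_iff mat_def)

lemma torus_map_inverse:
  assumes "N ** M = mat 1"
  shows "torus_map N (torus_map M x) = x"
proof -
  obtain v where "x = abs_torus v" by (rule abs_torus_cases)
  then show ?thesis
    by (simp add: torus_map.abs_eq matrix_vector_mul_assoc assms real_matrix_one
        flip: real_matrix_mult)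
qed

lemma inverse_eigenvector:
  assumes inverse: "N ** M = mat 1" and eigen: "real_matrix M *v a = \<mu> *s a" and "a \<noteq> 0"
  shows "\<mu> \<noteq> 0" and "real_matrix N *v a = (1 / \<mu>) *s a"
proof -
  have "a = real_matrix (N ** M) *v a" by (simp add: inverse real_matrix_one)
  also have "\<dots> = real_matrix N *v (\<mu> *s a)"
    by (simp add: real_matrix_mult flip: matrix_vector_mul_assoc add: eigen)
  also have "\<dots> = \<mu> *s (real_matrix N *v a)" by (simp add: vector_scalar_commute)
  finally have a: "a = \<mu> *s (real_matrix N *v a)" .
  show "\<mu> \<noteq> 0"
  proof
    assume "\<mu> = 0"
    then have "a = 0" using a by simp
    then show False using \<open>a \<noteq> 0\<close> by simp
  qed
  then show "real_matrix N *v a = (1 / \<mu>) *s a"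
    by (subst (2) a) simp
qed

text \<open>Serves twice: for \<open>A\<close> with the stable direction as \<open>a\<close>, and
  for the inverse of \<open>A\<close> with the unstable direction as \<open>a\<close>. Each estimate
  is thus proved only once.\<close>

locale contracting_direction =
  fixes M N :: "int^2^2" and a b :: "real^2" and \<mu> \<nu> :: real
  assumes inverse: "N ** M = mat 1"
    and eigen_a: "real_matrix M *v a = \<mu> *s a" and norm_a: "norm a = 1" and mu: "\<bar>\<mu>\<bar> < 1"
    and eigen_b: "real_matrix M *v b = \<nu> *s b" and norm_b: "norm b = 1" and nu: "1 < \<bar>\<nu>\<bar>"
    and span: "\<And>y. \<exists>\<alpha> \<beta>. y = \<alpha> *s a + \<beta> *s b"
begin

abbreviation "f \<equiv> torus_map M"
abbreviation "g \<equiv> torus_map N"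

lemma pow_inverse: "(g ^^ k) ((f ^^ k) x) = x"
proof (induction k)
  case (Suc k)
  have "(g ^^ Suc k) ((f ^^ Suc k) x) = (g ^^ k) (g (f ((f ^^ k) x)))" by (simp add: funpow_swap1)
  then show ?case using Suc by (simp only: torus_map_inverse[OF inverse])
qed simp

lemma mu_nonzero: "\<mu> \<noteq> 0" and eigen_a_inverse: "real_matrix N *v a = (1 / \<mu>) *s a"
proof -
  have "a \<noteq> 0" using norm_a by auto
  then show "\<mu> \<noteq> 0" "real_matrix N *v a = (1 / \<mu>) *s a"
    by (rule inverse_eigenvector[OF inverse eigen_a])+
qed

lemma norm_scale_a: "norm (c *s a) = \<bar>c\<bar>"
  by (simp add: scalar_mult_eq_scaleR norm_a)

lemma norm_scale_b: "norm (c *s b) = \<bar>c\<bar>"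
  by (simp add: scalar_mult_eq_scaleR norm_b)

lemma leaf_contracts:
  assumes "0 < \<delta>"
  obtains n where "\<And>x s k. \<bar>s\<bar> < R \<Longrightarrow> n \<le> k \<Longrightarrow> dist ((f ^^ k) x) ((f ^^ k) (shift (s *s a) x)) < \<delta>"
proof -
  \<comment> \<open>After \<open>k\<close> steps the displacement \<open>s *s a\<close> has length
    \<bar>s\<bar> * \<bar>\<mu>\<bar> ^ k. The modulus of \<open>R\<close> covers negative
    \<open>R\<close>, for which no \<open>s\<close> qualifies.\<close>
  have "(\<lambda>k. \<bar>R\<bar> * \<bar>\<mu>\<bar> ^ k) \<longlonglongrightarrow> \<bar>R\<bar> * 0"
    using mu by (intro tendsto_mult_left LIMSEQ_realpow_zero) auto
  then have "eventually (\<lambda>k. \<bar>R\<bar> * \<bar>\<mu>\<bar> ^ k < \<delta>) sequentially"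
    using assms by (auto intro: order_tendstoD)
  then obtain n where n: "\<And>k. n \<le> k \<Longrightarrow> \<bar>R\<bar> * \<bar>\<mu>\<bar> ^ k < \<delta>"
    by (auto simp: eventually_sequentially)
  show thesis
  proof (rule that)
    fix x s k assume "\<bar>s\<bar> < R" "n \<le> k"
    have "dist ((f ^^ k) x) ((f ^^ k) (shift (s *s a) x)) \<le> \<bar>s\<bar> * \<bar>\<mu>\<bar> ^ k"
      using dist_shift_le[of "(f ^^ k) x" "(s * \<mu> ^ k) *s a"]
      by (simp add: torus_map_pow_shift pow_eigenvector[OF eigen_a] norm_scale_a abs_mult power_abs)
    also have "\<dots> \<le> \<bar>R\<bar> * \<bar>\<mu>\<bar> ^ k" using \<open>\<bar>s\<bar> < R\<close> by (intro mult_right_mono) auto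
    also have "\<dots> < \<delta>" using n \<open>n \<le> k\<close> by simp
    finally show "dist ((f ^^ k) x) ((f ^^ k) (shift (s *s a) x)) < \<delta>" .
  qed
qed

text \<open>A nonzero component along \<open>b\<close> would grow like the powers of
  \<bar>\<nu>\<bar>, while the component along \<open>a\<close> stays bounded.\<close>

lemma bounded_orbit_in_leaf:
  assumes "\<And>k. norm (((*v) (real_matrix M) ^^ k) c) \<le> K"
  obtains s where "c = s *s a"
proof -
  obtain \<alpha> \<beta> where c: "c = \<alpha> *s a + \<beta> *s b" using span by blast
  have "\<beta> = 0"
  proof (rule ccontr)
    \<comment> \<open>At a late enough time the expanding component exceeds \<open>K\<close> plus
      \<bar>\<alpha>\<bar>, and \<bar>\<alpha>\<bar> bounds the contracting component at all
      times.\<close>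
    assume "\<beta> \<noteq> 0"
    obtain k where "(K + \<bar>\<alpha>\<bar>) / \<bar>\<beta>\<bar> < \<bar>\<nu>\<bar> ^ k" using real_arch_pow[OF nu] by blast
    then have "K + \<bar>\<alpha>\<bar> < \<bar>\<beta>\<bar> * \<bar>\<nu>\<bar> ^ k" using \<open>\<beta> \<noteq> 0\<close> by (simp add: field_simps)
    also have "\<dots> = norm ((\<beta> * \<nu> ^ k) *s b)" by (simp add: norm_scale_b abs_mult power_abs)
    also have "\<dots> = norm (((*v) (real_matrix M) ^^ k) c - (\<alpha> * \<mu> ^ k) *s a)"
      by (simp add: c pow_linear pow_eigenvector[OF eigen_a] pow_eigenvector[OF eigen_b])
    also have "\<dots> \<le> norm (((*v) (real_matrix M) ^^ k) c) + norm ((\<alpha> * \<mu> ^ k) *s a)"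
      by (rule norm_triangle_ineq4)
    also have "\<dots> \<le> K + \<bar>\<alpha>\<bar> * \<bar>\<mu>\<bar> ^ k"
      using assms by (simp add: norm_scale_a abs_mult power_abs)
    also have "\<dots> \<le> K + \<bar>\<alpha>\<bar> * 1"
      using mu by (intro add_left_mono mult_left_mono power_le_one) auto
    finally show False by simp
  qed
  then show thesis by (intro that[of \<alpha>]) (simp add: c)
qed

text \<open>A short displacement \<open>c\<close> from \<open>x\<close> to \<open>y\<close> is
  followed linearly: by induction its iterates remain the short displacements between the orbits,
  hence stay bounded. Only forward times are controlled, so \<open>y\<close> is placed on the
  contracting leaf of \<open>x\<close> and not identified with it.\<close>

lemma expansive:
  obtains \<delta> where "0 < \<delta>"
    "\<And>x y. (\<And>k. dist ((f ^^ k) x) ((f ^^ k) y) < \<delta>) \<Longrightarrow> \<exists>s. \<bar>s\<bar> < \<delta> \<and> y = shift (s *s a) x"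
proof -
  obtain K where K: "0 < K" "\<And>c. norm (real_matrix M *v c) \<le> norm c * K"
    using bounded_linear.pos_bounded[OF matrix_vector_mul_bounded_linear] by blast
  \<comment> \<open>Chosen so that \<open>?\<delta> * K + ?\<delta> = 1\<close>: an iterated
    displacement and a short one then differ by less than 1, and \<open>shift_eq_imp_eq\<close>
    identifies them.\<close>
  let ?\<delta> = "1 / (K + 1)"
  show thesis
  proof (rule that[of ?\<delta>])
    show "0 < ?\<delta>" using K by simp
    fix x y assume near: "\<And>k. dist ((f ^^ k) x) ((f ^^ k) y) < ?\<delta>"
    have "dist x y < ?\<delta>" using near[of 0] by simp
    then obtain c where c: "y = shift c x" "norm c < ?\<delta>" by (rule dist_less_shiftE)
    let ?c = "\<lambda>k. ((*v) (real_matrix M) ^^ k) c"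
    have small: "norm (?c k) < ?\<delta>" for k
    proof (induction k)
      case 0
      then show ?case using c by simp
    next
      case (Suc k)
      obtain d where d: "(f ^^ Suc k) y = shift d ((f ^^ Suc k) x)" "norm d < ?\<delta>"
        using near[of "Suc k"] by (rule dist_less_shiftE)
      have "norm (?c (Suc k) - d) \<le> norm (?c (Suc k)) + norm d" by (rule norm_triangle_ineq4)
      also have "\<dots> < ?\<delta> * K + ?\<delta>"
      proof (rule add_le_less_mono)
        have "norm (?c (Suc k)) \<le> norm (?c k) * K" using K(2)[of "?c k"] by simp
        also have "\<dots> \<le> ?\<delta> * K" using Suc K(1) by (intro mult_right_mono) auto
        finally show "norm (?c (Suc k)) \<le> ?\<delta> * K" .
      qed (rule d(2))
      also have "\<dots> = 1" using K(1) by (simp add: field_simps)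
      finally have "?c (Suc k) = d"
        using d(1) c(1) by (intro shift_eq_imp_eq[of _ "(f ^^ Suc k) x"]) (simp_all only: torus_map_pow_shift)
      then show ?case using d(2) by simp
    qed
    obtain s where s: "c = s *s a" using bounded_orbit_in_leaf small less_imp_le by metis
    then show "\<exists>s. \<bar>s\<bar> < ?\<delta> \<and> y = shift (s *s a) x" using c by (auto simp: norm_scale_a)
  qed
qed

text \<open>Expansivity is applied to the pair at time \<open>n\<close>; going back by
  \<open>g ^^ n\<close> stretches the displacement along \<open>a\<close> by the factor 1 /
  \<bar>\<mu>\<bar> ^ n.\<close>

lemma leaf_of_asymptotic:
  obtains \<delta> where "0 < \<delta>"
    "\<And>n x y. (\<And>k. n \<le> k \<Longrightarrow> dist ((f ^^ k) x) ((f ^^ k) y) < \<delta>) \<Longrightarrow>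
      \<exists>s. \<bar>s\<bar> < \<delta> / \<bar>\<mu>\<bar> ^ n \<and> y = shift (s *s a) x"
proof -
  obtain \<delta> where \<delta>: "0 < \<delta>"
    "\<And>x y. (\<And>k. dist ((f ^^ k) x) ((f ^^ k) y) < \<delta>) \<Longrightarrow> \<exists>s. \<bar>s\<bar> < \<delta> \<and> y = shift (s *s a) x"
    using expansive by blast
  show thesis
  proof (rule that[OF \<delta>(1)])
    fix n x y assume near: "\<And>k. n \<le> k \<Longrightarrow> dist ((f ^^ k) x) ((f ^^ k) y) < \<delta>"
    have "dist ((f ^^ k) ((f ^^ n) x)) ((f ^^ k) ((f ^^ n) y)) < \<delta>" for k
      using near[of "k + n"] by (simp add: funpow_add)
    then obtain s where s: "\<bar>s\<bar> < \<delta>" "(f ^^ n) y = shift (s *s a) ((f ^^ n) x)" using \<delta>(2) by blast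
    have "y = (g ^^ n) ((f ^^ n) y)" by (simp add: pow_inverse)
    also have "\<dots> = shift ((s * (1 / \<mu>) ^ n) *s a) x"
      by (simp only: s(2) torus_map_pow_shift pow_eigenvector[OF eigen_a_inverse] pow_inverse)
    finally have "y = shift ((s * (1 / \<mu>) ^ n) *s a) x" .
    moreover have "\<bar>s * (1 / \<mu>) ^ n\<bar> < \<delta> / \<bar>\<mu>\<bar> ^ n"
      using s(1) mu_nonzero by (simp add: abs_mult power_abs power_divide divide_strict_right_mono)
    ultimately show "\<exists>s. \<bar>s\<bar> < \<delta> / \<bar>\<mu>\<bar> ^ n \<and> y = shift (s *s a) x" by blast
  qed
qed

end

section \<open>Eigenvalues and eigenvectors of hyperbolic matrices\<close>

lemma eigenvalue_of_iff_charpoly: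
  fixes M :: "'a::field^2^2"
  shows "eigenvalue_of M l \<longleftrightarrow> l\<^sup>2 - (M$1$1 + M$2$2) * l + det M = 0"
proof -
  have "mat l *v v = l *s v" for v :: "'a^2"
    by (simp add: vec_eq_iff forall_2 matrix_vector_mult_def sum_2 mat_def)
  then have "eigenvalue_of M l \<longleftrightarrow> (\<exists>v. v \<noteq> 0 \<and> (M - mat l) *v v = 0)"
    by (simp add: eigenvalue_of_def matrix_vector_mult_diff_rdistrib)
  also have "\<dots> \<longleftrightarrow> \<not> invertible (M - mat l)"
    by (metis invertible_left_inverse matrix_left_invertible_ker)
  also have "\<dots> \<longleftrightarrow> det (M - mat l) = 0" by (simp add: invertible_det_nz)
  also have "\<dots> \<longleftrightarrow> l\<^sup>2 - (M$1$1 + M$2$2) * l + det M = 0"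
    by (simp add: det_2 mat_def algebra_simps power2_eq_square)
  finally show ?thesis .
qed

lemma det_invertible_int:
  fixes A :: "int^'n^'n"
  assumes "invertible A"
  shows "det A = 1 \<or> det A = -1"
proof -
  obtain B where "A ** B = mat 1" using assms by (auto simp: invertible_def)
  then have "det A * det B = 1" by (metis det_I det_mul)
  then show ?thesis by (auto simp: zmult_eq_1_iff)
qed

text \<open>A negative discriminant would force determinant 1 and a conjugate pair of roots on the
  unit circle. So the roots are real; their product has modulus 1 and neither has modulus 1, hence
  one lies on each side.\<close>

lemma hyperbolic_eigenvalues:
  assumes "hyperbolic A"
  obtains ls lu where "\<bar>ls\<bar> < 1" "1 < \<bar>lu\<bar>"
    "\<And>l. eigenvalue_of (real_matrix A) l \<longleftrightarrow> l = ls \<or> l = lu"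
proof -
  define t d where "t = A$1$1 + A$2$2" and "d = det A"
  have d: "d = 1 \<or> d = -1"
    using assms det_invertible_int by (auto simp: hyperbolic_def d_def)
  have real_ev: "eigenvalue_of (real_matrix A) l \<longleftrightarrow> l\<^sup>2 - t * l + d = 0" for l :: real
    by (simp add: eigenvalue_of_iff_charpoly det_2 t_def d_def)
  have no_unimodular: "cmod l \<noteq> 1" if "l\<^sup>2 - t * l + d = 0" for l :: complex
  proof -
    have "eigenvalue_of (map_matrix of_int A) l"
      using that by (simp add: eigenvalue_of_iff_charpoly det_2 t_def d_def)
    then show ?thesis using assms by (auto simp: hyperbolic_def)
  qed
  define D :: real where "D = (of_int t)\<^sup>2 - 4 * of_int d"
  have "0 \<le> D"
  proof (rule ccontr)
    assume neg: "\<not> 0 \<le> D"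
    have "0 \<le> D" if "d = -1" by (simp add: D_def that add_nonneg_nonneg)
    then have "d = 1" using d neg by blast
    \<comment> \<open>The root in the upper half plane; the square of its modulus is the
      determinant.\<close>
    let ?l = "Complex (t / 2) (sqrt (- D) / 2)"
    have "?l\<^sup>2 - t * ?l + d = 0"
      using neg by (simp add: complex_eq_iff power2_eq_square D_def field_simps)
    moreover have "cmod ?l = 1"
      using neg \<open>d = 1\<close> by (simp add: cmod_def power_divide D_def field_simps)
    ultimately show False using no_unimodular by blast
  qed
  define r1 r2 where "r1 = (t + sqrt D) / 2" and "r2 = (t - sqrt D) / 2"
  have sum: "r1 + r2 = t" by (simp add: r1_def r2_def field_simps)
  have prod: "r1 * r2 = d"
    using \<open>0 \<le> D\<close> by (simp add: r1_def r2_def field_simps flip: power2_eq_square) (simp add: D_def)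
  have factor: "l\<^sup>2 - t * l + d = (l - r1) * (l - r2)" for l :: real
    by (simp add: algebra_simps power2_eq_square flip: sum prod)
  have ev: "eigenvalue_of (real_matrix A) l \<longleftrightarrow> l = r1 \<or> l = r2" for l
    by (simp add: real_ev factor)
  have not1: "\<bar>l\<bar> \<noteq> 1" if "l = r1 \<or> l = r2" for l
  proof -
    have "l\<^sup>2 - t * l + d = 0" using that by (auto simp: factor)
    then have "complex_of_real (l\<^sup>2 - t * l + d) = 0" by (simp only: of_real_0)
    then show ?thesis using no_unimodular[of "complex_of_real l"] by simp
  qed
  have abs_prod: "\<bar>r1\<bar> * \<bar>r2\<bar> = 1" using d prod by (auto simp flip: abs_mult)
  show thesis
  proof (cases "\<bar>r1\<bar> < 1")
    case True
    then have "1 < \<bar>r2\<bar>" using abs_prod mult_mono[of "\<bar>r1\<bar>" 1 "\<bar>r2\<bar>" 1] not1[of r2]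
      by (smt (verit) mult_cancel_right1 mult_left_le)
    then show ?thesis using that True ev by blast
  next
    case False
    then have r1: "1 < \<bar>r1\<bar>" using not1[of r1] by auto
    then have "\<bar>r2\<bar> < 1" using abs_prod
      by (smt (verit) mult_le_cancel_left1)
    then show ?thesis using that r1 ev by blast
  qed
qed

lemma unit_eigenvector:
  assumes "eigenvalue_of M (l::real)"
  shows "\<exists>v. norm v = 1 \<and> M *v v = l *s v"
proof -
  obtain v where v: "v \<noteq> 0" "M *v v = l *s v" using assms by (auto simp: eigenvalue_of_def)
  then show ?thesis
    by (intro exI[of _ "(1 / norm v) *\<^sub>R v"])
      (simp add: matrix_vector_mult_scaleR scalar_mult_eq_scaleR)
qed

lemma hyperbolic_eigenvectors:
  assumes "hyperbolic A"
  shows "\<bar>stable_eigenvalue A\<bar> < 1" "1 < \<bar>unstable_eigenvalue A\<bar>"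
    "norm (stable_vector A) = 1" "norm (unstable_vector A) = 1"
    "real_matrix A *v stable_vector A = stable_eigenvalue A *s stable_vector A"
    "real_matrix A *v unstable_vector A = unstable_eigenvalue A *s unstable_vector A"
proof -
  obtain ls lu where l: "\<bar>ls\<bar> < 1" "1 < \<bar>lu\<bar>"
    "\<And>l. eigenvalue_of (real_matrix A) l \<longleftrightarrow> l = ls \<or> l = lu"
    using hyperbolic_eigenvalues[OF assms] by blast
  have ls: "stable_eigenvalue A = ls"
    unfolding stable_eigenvalue_def by (rule the_equality) (use l in auto)
  have lu: "unstable_eigenvalue A = lu"
    unfolding unstable_eigenvalue_def by (rule the_equality) (use l in auto)
  show "\<bar>stable_eigenvalue A\<bar> < 1" "1 < \<bar>unstable_eigenvalue A\<bar>" using l ls lu by auto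
  have "norm (stable_vector A) = 1 \<and> real_matrix A *v stable_vector A = stable_eigenvalue A *s stable_vector A"
    unfolding stable_vector_def by (rule someI_ex, rule unit_eigenvector) (simp add: l ls)
  then show "norm (stable_vector A) = 1"
    "real_matrix A *v stable_vector A = stable_eigenvalue A *s stable_vector A" by auto
  have "norm (unstable_vector A) = 1 \<and> real_matrix A *v unstable_vector A = unstable_eigenvalue A *s unstable_vector A"
    unfolding unstable_vector_def by (rule someI_ex, rule unit_eigenvector) (simp add: l lu)
  then show "norm (unstable_vector A) = 1"
    "real_matrix A *v unstable_vector A = unstable_eigenvalue A *s unstable_vector A" by auto
qed

text \<open>If the determinant \<open>D\<close> of the pair vanished, multiples of \<open>a\<close>
  and \<open>b\<close> would coincide and lie in both eigenspaces, forcing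
  \<open>a = 0\<close>.\<close>

lemma eigenvectors_span:
  fixes a b :: "real^2"
  assumes a: "M *v a = \<mu> *s a" "a \<noteq> 0" and b: "M *v b = \<nu> *s b" "b \<noteq> 0" and "\<mu> \<noteq> \<nu>"
  shows "\<exists>\<alpha> \<beta>. y = \<alpha> *s a + \<beta> *s b"
proof -
  define D where "D = a$1 * b$2 - a$2 * b$1"
  have "D \<noteq> 0"
  proof
    assume "D = 0"
    have parallel: "a $ i *s b = b $ i *s a" for i
      using exhaust_2[of i] \<open>D = 0\<close> by (auto simp: vec_eq_iff forall_2 D_def algebra_simps)
    have "a $ i = 0" for i
    proof -
      have "(\<nu> * a $ i) *s b = M *v (a $ i *s b)"
        by (simp add: vector_scalar_commute b mult.commute)
      also have "\<dots> = \<mu> *s (a $ i *s b)"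
        by (simp add: parallel vector_scalar_commute a mult.commute)
      finally have "((\<nu> - \<mu>) * a $ i) *s b = 0"
        by (simp add: algebra_simps vector_sub_rdistrib)
      then show ?thesis using \<open>b \<noteq> 0\<close> \<open>\<mu> \<noteq> \<nu>\<close> by simp
    qed
    then show False using \<open>a \<noteq> 0\<close> by (simp add: vec_eq_iff)
  qed
  \<comment> \<open>Cramer's rule.\<close>
  have "y = ((y$1 * b$2 - y$2 * b$1) / D) *s a + ((a$1 * y$2 - a$2 * y$1) / D) *s b"
    using \<open>D \<noteq> 0\<close> by (simp add: vec_eq_iff forall_2 field_simps) (simp add: D_def algebra_simps)
  then show ?thesis by blast
qed

lemma
  fixes A :: "int^2^2"
  assumes "invertible A"
  shows matrix_inv_right_int: "A ** matrix_inv A = mat 1"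
    and matrix_inv_left_int: "matrix_inv A ** A = mat 1"
    and matrix_inv_matrix_inv_int: "matrix_inv (matrix_inv A) = A"
proof -
  have *: "B ** matrix_inv B = mat 1 \<and> matrix_inv B ** B = mat 1" if "invertible B" for B :: "int^2^2"
    using that unfolding matrix_inv_def invertible_def by (rule someI_ex)
  then show inv: "A ** matrix_inv A = mat 1" "matrix_inv A ** A = mat 1" using assms by auto
  then have "invertible (matrix_inv A)" unfolding invertible_def by blast
  then have "matrix_inv A ** matrix_inv (matrix_inv A) = mat 1" using * by blast
  then show "matrix_inv (matrix_inv A) = A"
    using inv by (metis matrix_mul_assoc matrix_mul_lid matrix_mul_rid)
qed

text \<open>Passing to the inverse keeps the eigenvectors and inverts the eigenvalues, so the
  unstable direction becomes the contracting one.\<close>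

lemma hyperbolic_contracting:
  assumes "hyperbolic A"
  shows "contracting_direction A (matrix_inv A) (stable_vector A) (unstable_vector A)
      (stable_eigenvalue A) (unstable_eigenvalue A)"
    and "contracting_direction (matrix_inv A) A (unstable_vector A) (stable_vector A)
      (1 / unstable_eigenvalue A) (1 / stable_eigenvalue A)"
proof -
  note e = hyperbolic_eigenvectors[OF assms]
  have inv: "matrix_inv A ** A = mat 1" "A ** matrix_inv A = mat 1"
    using assms matrix_inv_left_int matrix_inv_right_int by (auto simp: hyperbolic_def)
  have nz: "stable_vector A \<noteq> 0" "unstable_vector A \<noteq> 0" using e by auto
  have ne: "stable_eigenvalue A \<noteq> unstable_eigenvalue A" using e by auto
  interpret s: contracting_direction A "matrix_inv A" "stable_vector A" "unstable_vector A"
      "stable_eigenvalue A" "unstable_eigenvalue A"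
    by standard (use e inv nz ne eigenvectors_span in auto)
  show "contracting_direction A (matrix_inv A) (stable_vector A) (unstable_vector A)
      (stable_eigenvalue A) (unstable_eigenvalue A)" by (rule s.contracting_direction_axioms)
  have "real_matrix (matrix_inv A) *v unstable_vector A = (1 / unstable_eigenvalue A) *s unstable_vector A"
    using inverse_eigenvector(2)[OF inv(1) e(6) nz(2)] .
  then show "contracting_direction (matrix_inv A) A (unstable_vector A) (stable_vector A)
      (1 / unstable_eigenvalue A) (1 / stable_eigenvalue A)"
    using s.eigen_a_inverse s.mu_nonzero e inv eigenvectors_span[OF e(6) nz(2) e(5) nz(1) ne[symmetric]]
    by unfold_locales (auto simp: field_simps)
qed

section \<open>The topology of the asymptotic groupoid\<close>

text \<open>Refers only to the metric and the dynamics, with no eigenvectors, so a conjugacy can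
  transport it.\<close>

definition close_pairs :: "int^2^2 \<Rightarrow> real \<Rightarrow> nat \<Rightarrow> (torus \<times> torus) set" where
  "close_pairs A \<delta> N = {(x, y). \<forall>k\<ge>N.
     dist ((torus_map A ^^ k) x) ((torus_map A ^^ k) y) < \<delta> \<and>
     dist ((torus_map (matrix_inv A) ^^ k) x) ((torus_map (matrix_inv A) ^^ k) y) < \<delta>}"

lemma asymptotic_groupoid_iff_close_pairs:
  "p \<in> asymptotic_groupoid A \<longleftrightarrow> (\<forall>\<delta>>0. \<exists>N. p \<in> close_pairs A \<delta> N)"
proof -
  obtain x y where p: "p = (x, y)" by (cases p)
  let ?d = "\<lambda>k. dist ((torus_map A ^^ k) x) ((torus_map A ^^ k) y)"
  let ?e = "\<lambda>k. dist ((torus_map (matrix_inv A) ^^ k) x) ((torus_map (matrix_inv A) ^^ k) y)"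
  have "?d \<longlonglongrightarrow> 0 \<and> ?e \<longlonglongrightarrow> 0 \<longleftrightarrow> (\<forall>\<delta>>0. eventually (\<lambda>k. ?d k < \<delta> \<and> ?e k < \<delta>) sequentially)"
    unfolding eventually_conj_iff tendsto_iff by auto
  then show ?thesis
    by (simp add: p asymptotic_groupoid_def close_pairs_def eventually_sequentially)
qed

lemma asymptotic_piece_iff:
  "(x, y) \<in> asymptotic_piece \<epsilon> A n \<longleftrightarrow> (\<exists>s t.
     y = shift (s *s stable_vector A) x \<and> y = shift (t *s unstable_vector A) x \<and>
     \<bar>stable_eigenvalue A\<bar> ^ n * \<bar>s\<bar> < \<epsilon> \<and> \<bar>t\<bar> / \<bar>unstable_eigenvalue A\<bar> ^ n < \<epsilon>)"
  (is "_ \<longleftrightarrow> ?R x y")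
proof
  assume "(x, y) \<in> asymptotic_piece \<epsilon> A n"
  then obtain u v where "x = abs_torus u" "y = abs_torus v" "?R (abs_torus u) (abs_torus v)"
    unfolding asymptotic_piece_def scalar_mult_eq_scaleR shift_abs by blast
  then show "?R x y" by simp
next
  assume R: "?R x y"
  obtain u where u: "x = abs_torus u" by (rule abs_torus_cases)
  obtain v where v: "y = abs_torus v" by (rule abs_torus_cases)
  show "(x, y) \<in> asymptotic_piece \<epsilon> A n"
    using R unfolding u v asymptotic_piece_def scalar_mult_eq_scaleR shift_abs by blast
qed

text \<open>Within one piece both displacements are bounded: the stable one shrinks uniformly under
  \<open>A\<close>, the unstable one under the inverse.\<close>

lemma asymptotic_piece_subset_close_pairs:
  assumes "hyperbolic A" "0 < \<delta>"
  obtains N where "asymptotic_piece \<epsilon> A n \<subseteq> close_pairs A \<delta> N"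
proof -
  interpret s: contracting_direction A "matrix_inv A" "stable_vector A" "unstable_vector A"
    "stable_eigenvalue A" "unstable_eigenvalue A"
    using assms(1) by (rule hyperbolic_contracting)
  interpret u: contracting_direction "matrix_inv A" A "unstable_vector A" "stable_vector A"
    "1 / unstable_eigenvalue A" "1 / stable_eigenvalue A"
    using assms(1) by (rule hyperbolic_contracting)
  obtain N1 where N1: "\<And>x s k. \<bar>s\<bar> < \<epsilon> / \<bar>stable_eigenvalue A\<bar> ^ n \<Longrightarrow> N1 \<le> k \<Longrightarrow>
      dist ((torus_map A ^^ k) x) ((torus_map A ^^ k) (shift (s *s stable_vector A) x)) < \<delta>"
    using s.leaf_contracts[OF assms(2)] by blast
  obtain N2 where N2: "\<And>x t k. \<bar>t\<bar> < \<epsilon> * \<bar>unstable_eigenvalue A\<bar> ^ n \<Longrightarrow> N2 \<le> k \<Longrightarrow>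
      dist ((torus_map (matrix_inv A) ^^ k) x)
        ((torus_map (matrix_inv A) ^^ k) (shift (t *s unstable_vector A) x)) < \<delta>"
    using u.leaf_contracts[OF assms(2)] by blast
  have pos: "0 < \<bar>stable_eigenvalue A\<bar> ^ n" "0 < \<bar>unstable_eigenvalue A\<bar> ^ n"
    using s.mu_nonzero s.nu by auto
  have "(x, y) \<in> close_pairs A \<delta> (max N1 N2)" if mem: "(x, y) \<in> asymptotic_piece \<epsilon> A n" for x y
  proof -
    obtain s t where s: "y = shift (s *s stable_vector A) x" "\<bar>stable_eigenvalue A\<bar> ^ n * \<bar>s\<bar> < \<epsilon>"
      and t: "y = shift (t *s unstable_vector A) x" "\<bar>t\<bar> / \<bar>unstable_eigenvalue A\<bar> ^ n < \<epsilon>"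
      using mem unfolding asymptotic_piece_iff by blast
    have "\<bar>s\<bar> < \<epsilon> / \<bar>stable_eigenvalue A\<bar> ^ n" "\<bar>t\<bar> < \<epsilon> * \<bar>unstable_eigenvalue A\<bar> ^ n"
      using s(2) t(2) pos by (simp_all only: pos_less_divide_eq pos_divide_less_eq mult.commute)
    then show ?thesis
      using N1[of s _ x] N2[of t _ x] by (simp add: close_pairs_def flip: s(1) t(1))
  qed
  then show thesis by (intro that[of "max N1 N2"]) auto
qed

text \<open>Expansivity in both time directions yields the two leaf displacements. The order of
  quantifiers matters: \<delta> depends on \<open>A\<close> alone and can be fixed before
  \<open>N\<close>.\<close>

lemma close_pairs_subset_asymptotic_piece:
  assumes "hyperbolic A"
  obtains \<delta> where "0 < \<delta>" "\<And>N \<epsilon>. 0 < \<epsilon> \<Longrightarrow> \<exists>n. close_pairs A \<delta> N \<subseteq> asymptotic_piece \<epsilon> A n"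
proof -
  let ?s = "\<bar>stable_eigenvalue A\<bar>" and ?u = "\<bar>unstable_eigenvalue A\<bar>"
  interpret s: contracting_direction A "matrix_inv A" "stable_vector A" "unstable_vector A"
    "stable_eigenvalue A" "unstable_eigenvalue A"
    using assms by (rule hyperbolic_contracting)
  interpret u: contracting_direction "matrix_inv A" A "unstable_vector A" "stable_vector A"
    "1 / unstable_eigenvalue A" "1 / stable_eigenvalue A"
    using assms by (rule hyperbolic_contracting)
  obtain \<delta>1 where \<delta>1: "0 < \<delta>1" "\<And>n x y. (\<And>k. n \<le> k \<Longrightarrow>
      dist ((torus_map A ^^ k) x) ((torus_map A ^^ k) y) < \<delta>1) \<Longrightarrow>
      \<exists>s. \<bar>s\<bar> < \<delta>1 / ?s ^ n \<and> y = shift (s *s stable_vector A) x"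
    using s.leaf_of_asymptotic by blast
  obtain \<delta>2 where \<delta>2: "0 < \<delta>2" "\<And>n x y. (\<And>k. n \<le> k \<Longrightarrow>
      dist ((torus_map (matrix_inv A) ^^ k) x) ((torus_map (matrix_inv A) ^^ k) y) < \<delta>2) \<Longrightarrow>
      \<exists>t. \<bar>t\<bar> < \<delta>2 / \<bar>1 / unstable_eigenvalue A\<bar> ^ n \<and> y = shift (t *s unstable_vector A) x"
    using u.leaf_of_asymptotic by blast
  show thesis
  proof (rule that[of "min \<delta>1 \<delta>2"])
    show "0 < min \<delta>1 \<delta>2" using \<delta>1 \<delta>2 by simp
    fix N and \<epsilon> :: real assume "0 < \<epsilon>"
    let ?R = "\<delta>1 / ?s ^ N" and ?R' = "\<delta>2 / \<bar>1 / unstable_eigenvalue A\<bar> ^ N"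
    \<comment> \<open>The displacement bounds \<open>?R\<close> and \<open>?R'\<close> are fixed by
      \<open>N\<close>, while the pieces exhaust every bounded range of displacements as
      \<open>n\<close> grows; hence any positive \<epsilon> will do.\<close>
    have "(\<lambda>n. ?s ^ n * ?R) \<longlonglongrightarrow> 0 * ?R" "(\<lambda>n. (1 / ?u) ^ n * ?R') \<longlonglongrightarrow> 0 * ?R'"
      using s.mu s.nu by (intro tendsto_mult_right LIMSEQ_realpow_zero; simp)+
    then have "eventually (\<lambda>n. ?s ^ n * ?R < \<epsilon> \<and> (1 / ?u) ^ n * ?R' < \<epsilon>) sequentially"
      using \<open>0 < \<epsilon>\<close> by (intro eventually_conj) (auto dest: order_tendstoD(2))
    then obtain n where n: "?s ^ n * ?R < \<epsilon>" "(1 / ?u) ^ n * ?R' < \<epsilon>"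
      by (auto simp: eventually_sequentially)
    have "(x, y) \<in> asymptotic_piece \<epsilon> A n" if mem: "(x, y) \<in> close_pairs A (min \<delta>1 \<delta>2) N" for x y
    proof -
      obtain s where s: "\<bar>s\<bar> < ?R" "y = shift (s *s stable_vector A) x"
        using \<delta>1(2)[of N x y] mem by (auto simp: close_pairs_def)
      obtain t where t: "\<bar>t\<bar> < ?R'" "y = shift (t *s unstable_vector A) x"
        using \<delta>2(2)[of N x y] mem by (auto simp: close_pairs_def)
      have "?s ^ n * \<bar>s\<bar> \<le> ?s ^ n * ?R" using s by (intro mult_left_mono) auto
      moreover have "(1 / ?u) ^ n * \<bar>t\<bar> \<le> (1 / ?u) ^ n * ?R'" using t by (intro mult_left_mono) auto
      then have "\<bar>t\<bar> / ?u ^ n \<le> (1 / ?u) ^ n * ?R'" by (simp add: power_divide)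
      ultimately have "?s ^ n * \<bar>s\<bar> < \<epsilon>" "\<bar>t\<bar> / ?u ^ n < \<epsilon>" using n by linarith+
      then show ?thesis using s(2) t(2) unfolding asymptotic_piece_iff by blast
    qed
    then show "\<exists>n. close_pairs A (min \<delta>1 \<delta>2) N \<subseteq> asymptotic_piece \<epsilon> A n"
      by (intro exI[of _ n]) auto
  qed
qed

text \<open>Asymptotic pairs do not distinguish the two directions of time, so a map that reverses
  the direction is as good as a conjugacy.\<close>

definition intertwines :: "(torus \<Rightarrow> torus) \<Rightarrow> int^2^2 \<Rightarrow> int^2^2 \<Rightarrow> bool" where
  "intertwines h A B \<longleftrightarrow>
     h \<circ> torus_map A = torus_map B \<circ> h \<and>
       h \<circ> torus_map (matrix_inv A) = torus_map (matrix_inv B) \<circ> h \<or>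
     h \<circ> torus_map A = torus_map (matrix_inv B) \<circ> h \<and>
       h \<circ> torus_map (matrix_inv A) = torus_map B \<circ> h"

lemma intertwines_inverse:
  assumes "intertwines h A B" and inv: "\<And>x. k (h x) = x" "\<And>x. h (k x) = x"
  shows "intertwines k B A"
proof -
  have swap: "k \<circ> g = f \<circ> k" if "h \<circ> f = g \<circ> h" for f g :: "torus \<Rightarrow> torus"
  proof
    fix x
    have "k (g x) = k ((g \<circ> h) (k x))" by (simp add: inv)
    then show "(k \<circ> g) x = (f \<circ> k) x" by (simp add: inv flip: that)
  qed
  show ?thesis using assms(1) swap unfolding intertwines_def by blast
qed

text \<open>Uniform continuity of \<open>h\<close> is applied separately at each time from
  \<open>N\<close> on, so \<open>N\<close> does not change. If \<open>h\<close> reverses time, the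
  forward and backward conditions trade places.\<close>

lemma map_close_pairs:
  assumes "intertwines h A B" "continuous_on UNIV h" "0 < \<delta>"
  obtains \<delta>' where "0 < \<delta>'" "\<And>N. map_prod h h ` close_pairs A \<delta>' N \<subseteq> close_pairs B \<delta> N"
proof -
  have "uniformly_continuous_on UNIV h"
    using assms(2) compact_UNIV_torus by (rule compact_uniformly_continuous)
  then obtain \<delta>' where \<delta>': "0 < \<delta>'" "\<And>x y. dist x y < \<delta>' \<Longrightarrow> dist (h x) (h y) < \<delta>"
    using assms(3) unfolding uniformly_continuous_on_def by (metis UNIV_I dist_commute)
  have pow: "(g ^^ n) (h x) = h ((f ^^ n) x)" if "h \<circ> f = g \<circ> h" for f g :: "torus \<Rightarrow> torus" and n x
    by (induction n) (simp_all add: fun_cong[OF that, simplified])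
  have "(h x, h y) \<in> close_pairs B \<delta> N" if "(x, y) \<in> close_pairs A \<delta>' N" for x y N
    using assms(1) unfolding intertwines_def
  proof (elim disjE conjE)
    assume "h \<circ> torus_map A = torus_map B \<circ> h"
      "h \<circ> torus_map (matrix_inv A) = torus_map (matrix_inv B) \<circ> h"
    then show ?thesis using that \<delta>'(2) by (simp add: close_pairs_def pow)
  next
    assume "h \<circ> torus_map A = torus_map (matrix_inv B) \<circ> h"
      "h \<circ> torus_map (matrix_inv A) = torus_map B \<circ> h"
    then show ?thesis using that \<delta>'(2) by (simp add: close_pairs_def pow)
  qed
  then show thesis using that[OF \<delta>'(1)] by auto
qed

section \<open>Isomorphism of the topological groupoids\<close>

lemma map_asymptotic_groupoid:
  assumes "intertwines h A B" "continuous_on UNIV h" "p \<in> asymptotic_groupoid A"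
  shows "map_prod h h p \<in> asymptotic_groupoid B"
  unfolding asymptotic_groupoid_iff_close_pairs
proof (intro allI impI)
  fix \<delta> :: real assume "0 < \<delta>"
  then obtain \<delta>' where "0 < \<delta>'" "\<And>N. map_prod h h ` close_pairs A \<delta>' N \<subseteq> close_pairs B \<delta> N"
    using map_close_pairs assms(1,2) by blast
  then show "\<exists>N. map_prod h h p \<in> close_pairs B \<delta> N"
    using assms(3) unfolding asymptotic_groupoid_iff_close_pairs by blast
qed

text \<open>The constants are chosen backwards: \<delta> by expansivity of \<open>B\<close>, then
  \<delta>' by continuity of \<open>h\<close>, then \<open>N\<close> by contraction for
  \<open>A\<close>, and last the index \<open>m\<close>.\<close>

lemma map_asymptotic_piece:
  assumes "hyperbolic A" "hyperbolic B" "0 < \<epsilon>'" "intertwines h A B" "continuous_on UNIV h"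
  obtains m where "map_prod h h ` asymptotic_piece \<epsilon> A n \<subseteq> asymptotic_piece \<epsilon>' B m"
proof -
  obtain \<delta> where \<delta>: "0 < \<delta>" "\<And>N \<epsilon>. 0 < \<epsilon> \<Longrightarrow> \<exists>m. close_pairs B \<delta> N \<subseteq> asymptotic_piece \<epsilon> B m"
    using close_pairs_subset_asymptotic_piece[OF assms(2)] by blast
  obtain \<delta>' where \<delta>': "0 < \<delta>'" "\<And>N. map_prod h h ` close_pairs A \<delta>' N \<subseteq> close_pairs B \<delta> N"
    using map_close_pairs[OF assms(4,5) \<delta>(1)] by blast
  obtain N where N: "asymptotic_piece \<epsilon> A n \<subseteq> close_pairs A \<delta>' N"
    using assms(1) \<delta>'(1) by (rule asymptotic_piece_subset_close_pairs)
  obtain m where "close_pairs B \<delta> N \<subseteq> asymptotic_piece \<epsilon>' B m"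
    using \<delta>(2) assms(3) by blast
  then show thesis using that[of m] N \<delta>'(2)[of N] by blast
qed

text \<open>Openness is tested piece by piece. Each piece for \<open>A\<close> goes into a single
  piece for \<open>B\<close>, on which \<open>U\<close> is the trace of an open subset of the
  product of two tori.\<close>

lemma openin_vimage_asymptotic_topology:
  assumes "hyperbolic A" "hyperbolic B" "0 < \<epsilon>'"
    and "intertwines h A B" "continuous_on UNIV h" "continuous_on UNIV k"
    and inv: "\<And>x. k (h x) = x" "\<And>x. h (k x) = x"
    and U: "openin (asymptotic_topology \<epsilon>' B) U"
  shows "openin (asymptotic_topology \<epsilon> A) (map_prod h h -` U)"
  unfolding openin_asymptotic_topology
proof (intro conjI allI subsetI)
  fix p assume "p \<in> map_prod h h -` U"
  then have "map_prod h h p \<in> asymptotic_groupoid B" using U by (auto simp: openin_asymptotic_topology)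
  \<comment> \<open>The preimage is taken in the whole type, so it lies in the groupoid of
    \<open>A\<close> only because \<open>k\<close> carries asymptotic pairs back.\<close>
  moreover have "intertwines k B A" using assms(4) inv by (rule intertwines_inverse)
  ultimately have "map_prod k k (map_prod h h p) \<in> asymptotic_groupoid A"
    using assms(6) map_asymptotic_groupoid by blast
  then show "p \<in> asymptotic_groupoid A" by (cases p) (simp add: inv)
next
  fix n
  let ?P = "asymptotic_piece \<epsilon> A n"
  obtain m where m: "map_prod h h ` ?P \<subseteq> asymptotic_piece \<epsilon>' B m"
    using map_asymptotic_piece assms(1-5) by blast
  obtain W where W: "open W" "U \<inter> asymptotic_piece \<epsilon>' B m = asymptotic_piece \<epsilon>' B m \<inter> W"
    using U unfolding openin_asymptotic_topology openin_open by blast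
  have "continuous_on UNIV (map_prod h h)"
    unfolding map_prod_def case_prod_beta
    by (intro continuous_on_Pair continuous_on_compose2[OF assms(5)] continuous_on_fst
        continuous_on_snd continuous_on_id) auto
  then have "open (map_prod h h -` W)" using W(1) by (simp add: open_vimage)
  moreover have "map_prod h h -` U \<inter> ?P = ?P \<inter> map_prod h h -` W" using m W(2) by blast
  ultimately show "openin (top_of_set ?P) (map_prod h h -` U \<inter> ?P)"
    unfolding openin_open by blast
qed

lemma intertwines_transport:
  assumes "hyperbolic A" "hyperbolic B" "0 < \<epsilon>" "0 < \<epsilon>'"
    and hk: "homeomorphism UNIV UNIV h k" and "intertwines h A B"
  obtains \<phi> where "cstar_transport (asymptotic_cstar \<epsilon> A) (asymptotic_cstar \<epsilon>' B) \<phi>"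
proof -
  let ?S = "asymptotic_topology \<epsilon> A" and ?T = "asymptotic_topology \<epsilon>' B"
  have inv: "\<And>x. k (h x) = x" "\<And>x. h (k x) = x" using hk by (auto simp: homeomorphism_def)
  have cont: "continuous_on UNIV h" "continuous_on UNIV k" using hk by (auto simp: homeomorphism_def)
  have inter: "intertwines k B A" using assms(6) inv by (rule intertwines_inverse)
  have h: "openin ?S (map_prod h h -` U)" if "openin ?T U" for U
    using openin_vimage_asymptotic_topology assms(1,2,4,6) cont inv that by blast
  have k: "openin ?T (map_prod k k -` U)" if "openin ?S U" for U
    using openin_vimage_asymptotic_topology assms(1,2,3) inter cont inv that by blast
  have cm: "continuous_map X Y f" if "\<And>U. openin Y U \<Longrightarrow> openin X (f -` U)" "f ` topspace X \<subseteq> topspace Y"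
    for X Y :: "(torus \<times> torus) topology" and f
  proof -
    have "{x \<in> topspace X. f x \<in> U} = f -` U" if "openin Y U" for U
      using openin_subset[OF \<open>\<And>U. openin Y U \<Longrightarrow> openin X (f -` U)\<close>[OF that]] by auto
    then show ?thesis using that by (auto simp: continuous_map_def)
  qed
  have comp: "map_prod k k -` (map_prod h h -` U) = U" "map_prod h h -` (map_prod k k -` U) = U" for U
    by (auto simp: inv)
  \<comment> \<open>The preimage of \<open>topspace ?S\<close> under \<open>map_prod k k\<close> is
    open in \<open>?T\<close>, hence inside \<open>topspace ?T\<close>; that preimage is the image
    under \<open>map_prod h h\<close>.\<close>
  have hS: "map_prod h h ` topspace ?S \<subseteq> topspace ?T"
    using openin_subset[OF k[OF openin_topspace]] inv by (auto simp: subset_eq)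
  have kT: "map_prod k k ` topspace ?T \<subseteq> topspace ?S"
    using openin_subset[OF h[OF openin_topspace]] inv by (auto simp: subset_eq)
  have "homeomorphic_maps ?S ?T (map_prod h h) (map_prod k k)"
    using cm[OF h hS] cm[OF k kT] by (auto simp: homeomorphic_maps_def inv)
  then interpret groupoid_homeomorphism ?S ?T h k by unfold_locales (simp_all add: inv)
  show thesis using that groupoid_cstar_transport unfolding asymptotic_cstar_def by blast
qed

text \<open>Eigenvalues of the inverse are reciprocals of eigenvalues of \<open>A\<close>, and
  taking reciprocals preserves the unit circle.\<close>

lemma hyperbolic_matrix_inv:
  assumes "hyperbolic A"
  shows "hyperbolic (matrix_inv A)"
proof -
  have "invertible A" using assms by (simp add: hyperbolic_def)
  note inv = matrix_inv_right_int[OF this] matrix_inv_left_int[OF this]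
  let ?c = "\<lambda>A. map_matrix of_int A :: complex^2^2"
  have c_mult: "?c M ** ?c N = ?c (M ** N)" for M N
    by (simp add: vec_eq_iff matrix_matrix_mult_def)
  have c_one: "?c (mat 1) = mat 1" by (simp add: vec_eq_iff mat_def)
  have "cmod l \<noteq> 1" if l: "eigenvalue_of (?c (matrix_inv A)) l" for l
  proof
    assume "cmod l = 1"
    then have "l \<noteq> 0" by auto
    obtain v where v: "v \<noteq> 0" "?c (matrix_inv A) *v v = l *s v" using l by (auto simp: eigenvalue_of_def)
    have "v = (?c A ** ?c (matrix_inv A)) *v v" by (simp add: c_mult c_one inv)
    also have "\<dots> = l *s (?c A *v v)"
      by (simp add: v vector_scalar_commute flip: matrix_vector_mul_assoc)
    finally have "(1 / l) *s v = (1 / l) *s (l *s (?c A *v v))" by simp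
    then have "?c A *v v = (1 / l) *s v" using \<open>l \<noteq> 0\<close> by simp
    then have "eigenvalue_of (?c A) (1 / l)" using v(1) by (auto simp: eigenvalue_of_def)
    moreover have "cmod (1 / l) = 1" using \<open>cmod l = 1\<close> by (simp add: norm_divide)
    ultimately show False using assms unfolding hyperbolic_def by blast
  qed
  moreover have "invertible (matrix_inv A)" using inv unfolding invertible_def by blast
  ultimately show ?thesis unfolding hyperbolic_def by blast
qed

theorem mainTheorem4:
  fixes A B :: "int^2^2" and \<epsilon>\<^sub>1 \<epsilon>\<^sub>2 \<epsilon>\<^sub>3 :: real
  assumes "hyperbolic A" and "hyperbolic B"
    and "\<epsilon>\<^sub>1 > 0" and "\<epsilon>\<^sub>2 > 0" and "\<epsilon>\<^sub>3 > 0"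
  shows
    "(topologically_conjugate A B \<longrightarrow>
        cstar_isomorphic (asymptotic_cstar \<epsilon>\<^sub>1 A) (asymptotic_cstar \<epsilon>\<^sub>2 B) \<and>
        (\<forall>\<tau>\<^sub>A \<tau>\<^sub>B.
           unique_tracial_state (asymptotic_cstar \<epsilon>\<^sub>1 A) \<tau>\<^sub>A \<and>
           unique_tracial_state (asymptotic_cstar \<epsilon>\<^sub>2 B) \<tau>\<^sub>B \<longrightarrow>
           trace_K0 \<tau>\<^sub>A ` carrier (K0 (asymptotic_cstar \<epsilon>\<^sub>1 A)) =
           trace_K0 \<tau>\<^sub>B ` carrier (K0 (asymptotic_cstar \<epsilon>\<^sub>2 B)))) \<and>
     (\<forall>\<tau>\<^sub>A \<tau>\<^sub>A'.
        unique_tracial_state (asymptotic_cstar \<epsilon>\<^sub>1 A) \<tau>\<^sub>A \<and>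
        unique_tracial_state (asymptotic_cstar \<epsilon>\<^sub>3 (matrix_inv A)) \<tau>\<^sub>A' \<longrightarrow>
        trace_K0 \<tau>\<^sub>A ` carrier (K0 (asymptotic_cstar \<epsilon>\<^sub>1 A)) =
        trace_K0 \<tau>\<^sub>A' ` carrier (K0 (asymptotic_cstar \<epsilon>\<^sub>3 (matrix_inv A))))"
proof (intro conjI impI)
  have inv: "invertible A" "invertible B" using assms by (simp_all add: hyperbolic_def)
  {
    assume "topologically_conjugate A B"
    then obtain h k where hk: "homeomorphism UNIV UNIV h k" and h: "h \<circ> torus_map A = torus_map B \<circ> h"
      by (auto simp: topologically_conjugate_def)
    have "h (torus_map (matrix_inv A) x) = torus_map (matrix_inv B) (h x)" for x
    proof -
      \<comment> \<open>The conjugacy is evaluated at the preimage of \<open>x\<close> under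
        \<open>A\<close>; applying the inverse of \<open>B\<close> then gives the claim.\<close>
      have "h x = torus_map B (h (torus_map (matrix_inv A) x))"
        using fun_cong[OF h, of "torus_map (matrix_inv A) x"]
        by (simp add: torus_map_inverse[OF matrix_inv_right_int[OF inv(1)]])
      then show ?thesis by (simp add: torus_map_inverse[OF matrix_inv_left_int[OF inv(2)]])
    qed
    then have "intertwines h A B" using h by (auto simp: intertwines_def)
    then obtain \<phi> where "cstar_transport (asymptotic_cstar \<epsilon>\<^sub>1 A) (asymptotic_cstar \<epsilon>\<^sub>2 B) \<phi>"
      using intertwines_transport[OF assms(1,2,3,4) hk] by blast
    then interpret cstar_transport "asymptotic_cstar \<epsilon>\<^sub>1 A" "asymptotic_cstar \<epsilon>\<^sub>2 B" \<phi> .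
    show "cstar_isomorphic (asymptotic_cstar \<epsilon>\<^sub>1 A) (asymptotic_cstar \<epsilon>\<^sub>2 B)" by (rule isomorphic)
    show "\<forall>\<tau>\<^sub>A \<tau>\<^sub>B.
           unique_tracial_state (asymptotic_cstar \<epsilon>\<^sub>1 A) \<tau>\<^sub>A \<and>
           unique_tracial_state (asymptotic_cstar \<epsilon>\<^sub>2 B) \<tau>\<^sub>B \<longrightarrow>
           trace_K0 \<tau>\<^sub>A ` carrier (K0 (asymptotic_cstar \<epsilon>\<^sub>1 A)) =
           trace_K0 \<tau>\<^sub>B ` carrier (K0 (asymptotic_cstar \<epsilon>\<^sub>2 B))"
      using unique_trace_K0_image_eq by blast
  }
  \<comment> \<open>The identity is a time-reversing map here, by the second alternative of
    \<open>intertwines\<close>, because inverting twice gives back \<open>A\<close>.\<close>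
  have "intertwines id A (matrix_inv A)"
    by (simp add: intertwines_def matrix_inv_matrix_inv_int[OF inv(1)])
  moreover have "homeomorphism UNIV UNIV (id :: torus \<Rightarrow> torus) id" by (simp add: homeomorphism_def)
  ultimately obtain \<phi> where
    "cstar_transport (asymptotic_cstar \<epsilon>\<^sub>1 A) (asymptotic_cstar \<epsilon>\<^sub>3 (matrix_inv A)) \<phi>"
    using intertwines_transport[OF assms(1) hyperbolic_matrix_inv[OF assms(1)] assms(3,5)] by blast
  then interpret cstar_transport "asymptotic_cstar \<epsilon>\<^sub>1 A" "asymptotic_cstar \<epsilon>\<^sub>3 (matrix_inv A)" \<phi> .
  show "\<forall>\<tau>\<^sub>A \<tau>\<^sub>A'.
        unique_tracial_state (asymptotic_cstar \<epsilon>\<^sub>1 A) \<tau>\<^sub>A \<and>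
        unique_tracial_state (asymptotic_cstar \<epsilon>\<^sub>3 (matrix_inv A)) \<tau>\<^sub>A' \<longrightarrow>
        trace_K0 \<tau>\<^sub>A ` carrier (K0 (asymptotic_cstar \<epsilon>\<^sub>1 A)) =
        trace_K0 \<tau>\<^sub>A' ` carrier (K0 (asymptotic_cstar \<epsilon>\<^sub>3 (matrix_inv A)))"
    using unique_trace_K0_image_eq by blast
qed

end
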